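(* Let ${\bf b}$ be a $0^m1^n$-sequence and let $\natural_{\bf b}=1_{\bf b}\otimes\natural:\mathbb T^{\bf b}\otimes\wedge^\infty\mathbb V\to\mathbb T^{\bf b}\otimes\wedge^\infty\mathbb W$. (1) The isomorphism $\natural_{\bf b}$ respects the Bruhat orderings (that is, $f\succeq_{({\bf b},0^\infty)}g$ if and only if $f^\natural\succeq_{({\bf b},1^\infty)}g^\natural$), and hence extends to an isomorphism of the $B$-completions $\natural_{\bf b}:\mathbb T^{\bf b}\widehat\otimes\wedge^\infty\mathbb V\to\mathbb T^{\bf b}\widehat\otimes\wedge^\infty\mathbb W$. (2) $\natural_{\bf b}$ commutes with the bar involutions. (3) $\natural_{\bf b}$ preserves the canonical and dual canonical bases. More precisely, $\natural_{\bf b}(M^{{\bf b},0}_f)=M^{{\bf b},1}_{f^\natural}$, $\natural_{\bf b}(T^{{\bf b},0}_f)=T^{{\bf b},1}_{f^\natural}$ and $\natural_{\bf b}(L^{{\bf b},0}_f)=L^{{\bf b},1}_{f^\natural}$ for all $f\in\mathbb Z^{m+n}\times\mathbb Z^\infty_+$. (4) $\ell^{{\bf b},0}_{gf}(q)=\ell^{{\bf b},1}_{g^\natural f^\natural}(q)$ and $t^{{\bf b},0}_{gf}(q)=t^{{\bf b},1}_{g^\natural f^\natural}(q)$ for all $g,f\in\mathbb Z^{m+n}\times\mathbb Z^\infty_+$.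
   Context: **Quantum group.** Let $q$ be an indeterminate; $\overline{\phantom{x}}$ is the automorphism of $\mathbb{Q}(q)$ with $\overline{q}=q^{-1}$. $U_q(\mathfrak{gl}_\infty)$ is the $\mathbb{Q}(q)$-algebra generated by $E_a,F_a,K_a^{\pm1}$ ($a\in\mathbb{Z}$) with relations: the $K_a$ commute; $K_aE_bK_a^{-1}=q^{\delta_{a,b}-\delta_{a,b+1}}E_b$; $K_aF_bK_a^{-1}=q^{\delta_{a,b+1}-\delta_{a,b}}F_b$; $E_aF_b-F_bE_a=\delta_{a,b}(K_{a,a+1}-K_{a+1,a})/(q-q^{-1})$, where $K_{a,b}=K_aK_b^{-1}$; $E_a^2E_b+E_bE_a^2=(q+q^{-1})E_aE_bE_a$ if $|a-b|=1$, $E_aE_b=E_bE_a$ if $|a-b|>1$, and the same for the $F$'s. Its bar involution is the anti-linear ring automorphism fixing $E_a,F_a$ and sending $K_a\mapsto K_a^{-1}$. Comultiplication: $\Delta(E_a)=1\otimes E_a+E_a\otimes K_{a+1,a}$, $\Delta(F_a)=F_a\otimes1+K_{a,a+1}\otimes F_a$, $\Delta(K_a)=K_a\otimes K_a$. $\mathbb V$ has basis $\{v_a\}_{a\in\mathbb Z}$ with $K_av_b=q^{\delta_{ab}}v_b$, $E_av_b=\delta_{a+1,b}v_a$, $F_av_b=\delta_{a,b}v_{a+1}$; $\mathbb W$ has basis $\{w_a\}_{a\in\mathbb Z}$ with $K_aw_b=q^{-\delta_{ab}}w_b$, $E_aw_b=\delta_{a,b}w_{a+1}$, $F_aw_b=\delta_{a+1,b}w_a$.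 **Fock space.** A $0^m1^n$-sequence is ${\bf b}=(b_1,\dots,b_{m+n})$ with $m$ entries $0$ and $n$ entries $1$. $\mathbb T^{\bf b}=\mathbb V^{b_1}\otimes\cdots\otimes\mathbb V^{b_{m+n}}$ with $\mathbb V^0=\mathbb V$, $\mathbb V^1=\mathbb W$. For $f\in\mathbb Z^{m+n}$ (functions $[m+n]=\{1,\dots,m+n\}\to\mathbb Z$) let $M^{\bf b}_f$ be the tensor of basis vectors whose $i$-th factor is $v_{f(i)}$ if $b_i=0$, $w_{f(i)}$ if $b_i=1$. For any finite $0$-$1$ sequence ${\bf b}$ put $\sharp_{\bf b}(f,a,j)=\sum_{i\ge j,\,f(i)\le a}(-1)^{b_i}$; the Bruhat order is: $g\preceq_{\bf b}f$ iff $\sharp_{\bf b}(g,a,j)\le\sharp_{\bf b}(f,a,j)$ for all $a\in\mathbb Z$ and all positions $j$, with equality for $j=1$. **Infinite $q$-wedges.** $\mathbb Z^\infty_+$ is the set of $f:\{\underline1,\underline2,\dots\}\to\mathbb Z$ with $f(\underline1)>f(\underline2)>\cdots$ and $f(\underline t)=1-t$ for $t\gg0$; $\mathbb Z^\infty_-$ is the set of such $f$ with $f(\underline1)<f(\underline2)<\cdots$ and $f(\underline t)=t$ for $t\gg0$. $\wedge^\infty\mathbb V$ is the $U_q(\mathfrak{gl}_\infty)$-module with basis $\mathcal V_f=v_{f(\underline1)}\wedge v_{f(\underline2)}\wedge\cdots$ ($f\in\mathbb Z^\infty_+$), where $E_a$ replaces $v_{a+1}$ by $v_a$ (zero if $a+1$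 is not a value of $f$ or $a$ is), $F_a$ replaces $v_a$ by $v_{a+1}$ (zero if $a$ is not a value of $f$ or $a+1$ is), and $K_a\mathcal V_f=q^{\#\{i:f(\underline i)=a\}}\mathcal V_f$. $\wedge^\infty\mathbb W$ has basis $\mathcal W_f=w_{f(\underline1)}\wedge w_{f(\underline2)}\wedge\cdots$ ($f\in\mathbb Z^\infty_-$), where $E_a$ replaces $w_a$ by $w_{a+1}$ and $F_a$ replaces $w_{a+1}$ by $w_a$ (zero when impossible or when the new value already occurs), and $K_a\mathcal W_f=q^{-\#\{i:f(\underline i)=a\}}\mathcal W_f$. For a partition $\lambda$ put $|\lambda\rangle=v_{\lambda_1}\wedge v_{\lambda_2-1}\wedge v_{\lambda_3-2}\wedge\cdots$ and $|\lambda_*\rangle=w_{1-\lambda_1}\wedge w_{2-\lambda_2}\wedge w_{3-\lambda_3}\wedge\cdots$. The map $\natural:\wedge^\infty\mathbb V\to\wedge^\infty\mathbb W$, $|\lambda\rangle\mapsto|\lambda'_*\rangle$ ($\lambda'$ the conjugate partition), is linear (and an isomorphism of modules over the subalgebra $U_q(\mathfrak{sl}_\infty)$ generated by $E_a,F_a,K_{a,a+1}$). **Standard bases, orders, completions.** For $f=(f_{[m+n]},f_{[\underline\infty]})\in\mathbb Z^{m+n}\times\mathbb Z^\infty_+$ (resp. $\mathbb Z^{m+n}\times\mathbb Z^\infty_-$) set $M^{{\bf b},0}_f=M^{\bf b}_{f_{[m+n]}}\otimes\mathcal V_{f_{[\underline\infty]}}$ (resp. $M^{{\bf b},1}_f=M^{\bf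 b}_{f_{[m+n]}}\otimes\mathcal W_{f_{[\underline\infty]}}$). For $\varepsilon\in\{0,1\}$, $g\preceq_{({\bf b},\varepsilon^\infty)}f$ means that for all sufficiently large $N$ the restrictions to the ordered set $1,\dots,m+n,\underline1,\dots,\underline N$ satisfy $g\preceq_{({\bf b},\varepsilon^N)}f$. The $B$-completion $\mathbb T^{\bf b}\widehat\otimes\wedge^\infty\mathbb V$ (resp. $\mathbb T^{\bf b}\widehat\otimes\wedge^\infty\mathbb W$) is spanned by formal, possibly infinite sums $M^{{\bf b},\varepsilon}_f+\sum_{g\prec f}r_gM^{{\bf b},\varepsilon}_g$, with $\varepsilon=0$ (resp. $1$) and $\prec\,=\,\prec_{({\bf b},\varepsilon^\infty)}$. For $f\in\mathbb Z^{m+n}\times\mathbb Z_+^\infty$, $f^\natural\in\mathbb Z^{m+n}\times\mathbb Z^\infty_-$ is defined by $f^\natural(i)=f(i)$ for $i\in[m+n]$ and $\mathcal W_{f^\natural_{[\underline\infty]}}=\natural(\mathcal V_{f_{[\underline\infty]}})$. **Bar maps.** For $k\ge1$ let $U_k$ be the subalgebra generated by $E_a,F_a,K_a^{\pm1},K_{a+1}^{\pm1}$, $-k\le a\le k-1$, with positive and negative parts $U_k^\pm$, and let $\Theta^{(k)}=\sum_\mu\Theta^{(k)}_\mu$, $\Theta^{(k)}_\mu\in U^+_{k,\mu}\otimes U^-_{k,-\mu}$, be its quasi-$\mathcal R$-matrix: the unique such formal sum with $\Theta^{(k)}_0=1\otimes1$ and $\Delta(u)\Theta^{(k)}=\Theta^{(k)}\,\overline{\Delta(\overline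 u)}$ for all $u\in U_k$. Define anti-linear maps $\psi^{(k)}$ inductively over tensor factors: $\psi^{(k)}$ fixes basis vectors $v_a,w_a$ of a single factor, and $\psi^{(k)}(x\otimes y)=\Theta^{(k)}(\psi^{(k)}(x)\otimes y)$ for $y$ a basis vector ($v_a$, $w_a$, $\mathcal V_h$ or $\mathcal W_h$) of the last factor (for $k$ at least the absolute values of the indices in the $\mathbb T^{\bf b}$-part). The bar map is $\overline{M^{{\bf b},\varepsilon}_f}=\lim_{\ell\to\infty}\psi^{(\ell)}(M^{{\bf b},\varepsilon}_f)$ (coefficients stabilize), which has the form $M^{{\bf b},\varepsilon}_f+\sum_{g\prec f}r_{gf}(q)M^{{\bf b},\varepsilon}_g$ with $r_{gf}\in\mathbb Z[q,q^{-1}]$ and extends to an anti-linear involution of the $B$-completion. **Bases.** For $\varepsilon\in\{0,1\}$, the canonical and dual canonical basis elements $T^{{\bf b},\varepsilon}_f=M^{{\bf b},\varepsilon}_f+\sum_{g\prec f}t^{{\bf b},\varepsilon}_{gf}(q)M^{{\bf b},\varepsilon}_g$ and $L^{{\bf b},\varepsilon}_f=M^{{\bf b},\varepsilon}_f+\sum_{g\prec f}\ell^{{\bf b},\varepsilon}_{gf}(q)M^{{\bf b},\varepsilon}_g$ are the unique bar-invariant elements of the $B$-completion with $t^{{\bf b},\varepsilon}_{gf}\in q\mathbb Z[q]$, $\ell^{{\bf b},\varepsilon}_{gf}\in q^{-1}\mathbb Z[q^{-1}]$; put $t_{ff}=\ell_{ff}=1$ and $t_{gf}=\ell_{gf}=0$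 if $g\not\preceq f$. *)

theory Defs
  imports
    "HOL-Computational_Algebra.Computational_Algebra"
    "HOL-Library.Poly_Mapping"
    "HOL-Library.Product_Plus"
begin

section \<open>The field of rational functions and its bar automorphism\<close>

type_synonym qfield = "rat poly fract"

definition qq :: qfield where
  "qq = to_fract [:0, 1:]"

text \<open>The bar automorphism sends \<open>p(q) / r(q)\<close> to \<open>p(q\<^sup>-\<^sup>1) / r(q\<^sup>-\<^sup>1)\<close>; \<open>eval_at_inv p\<close> is
  \<open>p(q\<^sup>-\<^sup>1)\<close>.\<close>

definition eval_at_inv :: "rat poly \<Rightarrow> qfield" where
  "eval_at_inv p = poly (map_poly (\<lambda>c. to_fract [:c:]) p) (inverse qq)"

definition qbar :: "qfield \<Rightarrow> qfield" where
  "qbar x =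
     (THE y. \<exists>p r. r \<noteq> 0 \<and> x = to_fract p / to_fract r \<and> y = eval_at_inv p / eval_at_inv r)"

definition q_Zq :: "qfield set" where
  "q_Zq = {qq * poly (map_poly of_int p) qq | p :: int poly. True}"

definition qinv_Zqinv :: "qfield set" where
  "qinv_Zqinv = {inverse qq * poly (map_poly of_int p) (inverse qq) | p :: int poly. True}"


section \<open>Vector spaces with a basis\<close>

text \<open>A vector space with basis indexed by 'i is \<open>'i \<Rightarrow>\<^sub>0 qfield\<close>. In \<open>tensor p x y\<close> the
  function p encodes a pair of basis indices as an index of the tensor product.\<close>

definition scal :: "qfield \<Rightarrow> ('i \<Rightarrow>\<^sub>0 qfield) \<Rightarrow> ('i \<Rightarrow>\<^sub>0 qfield)" where
  "scal c x = Poly_Mapping.map ((*) c) x"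

abbreviation basis :: "'i \<Rightarrow> ('i \<Rightarrow>\<^sub>0 qfield)" where
  "basis i \<equiv> Poly_Mapping.single i 1"

definition linext :: "('i \<Rightarrow> ('j \<Rightarrow>\<^sub>0 qfield)) \<Rightarrow> ('i \<Rightarrow>\<^sub>0 qfield) \<Rightarrow> ('j \<Rightarrow>\<^sub>0 qfield)" where
  "linext \<phi> x = (\<Sum>i\<in>Poly_Mapping.keys x. scal (Poly_Mapping.lookup x i) (\<phi> i))"

definition tensor ::
  "('i \<Rightarrow> 'j \<Rightarrow> 'l) \<Rightarrow> ('i \<Rightarrow>\<^sub>0 qfield) \<Rightarrow> ('j \<Rightarrow>\<^sub>0 qfield) \<Rightarrow> ('l \<Rightarrow>\<^sub>0 qfield)" where
  "tensor p x y = linext (\<lambda>i. linext (\<lambda>j. basis (p i j)) y) x"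


section \<open>The quantum group\<close>

datatype 'g fmon = FMon (letters: "'g list")

instantiation fmon :: (type) monoid_add
begin

definition zero_fmon :: "'a fmon" where
  "0 = FMon []"

definition plus_fmon :: "'a fmon \<Rightarrow> 'a fmon \<Rightarrow> 'a fmon" where
  "u + w = FMon (letters u @ letters w)"

instance
  by standard (simp_all add: zero_fmon_def plus_fmon_def)

end

datatype uqgen = GE int | GF int | GK int | GKinv int

text \<open>The free algebra A on the generators is the monoid algebra of the free monoid, and
  \<open>A \<otimes> A\<close> is the monoid algebra of the product monoid. With I the two-sided ideal of
  A generated by the relations, the quantum group is \<open>U = A / I\<close> and
  \<open>U \<otimes> U = (A \<otimes> A) / (I \<otimes> A + A \<otimes> I)\<close>. Elements of U and \<open>U \<otimes> U\<close> are handled through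
  representatives in \<open>uqfree\<close> and \<open>uqfree2\<close>; equality in \<open>U \<otimes> U\<close> is \<open>uq2_eq\<close>.\<close>

type_synonym uqfree = "uqgen fmon \<Rightarrow>\<^sub>0 qfield"
type_synonym uqfree2 = "(uqgen fmon \<times> uqgen fmon) \<Rightarrow>\<^sub>0 qfield"

abbreviation gen :: "uqgen \<Rightarrow> uqfree" where
  "gen g \<equiv> basis (FMon [g])"

abbreviation EE :: "int \<Rightarrow> uqfree" where "EE a \<equiv> gen (GE a)"
abbreviation FF :: "int \<Rightarrow> uqfree" where "FF a \<equiv> gen (GF a)"
abbreviation KK :: "int \<Rightarrow> uqfree" where "KK a \<equiv> gen (GK a)"
abbreviation KKinv :: "int \<Rightarrow> uqfree" where "KKinv a \<equiv> gen (GKinv a)"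
abbreviation KK2 :: "int \<Rightarrow> int \<Rightarrow> uqfree" where "KK2 a b \<equiv> KK a * KKinv b"

definition kdelta :: "int \<Rightarrow> int \<Rightarrow> int" where
  "kdelta a b = (if a = b then 1 else 0)"

definition uq_rels :: "uqfree set" where
  "uq_rels =
     {KK a * KK b - KK b * KK a | a b. True} \<union>
     {KK a * KKinv a - 1 | a. True} \<union>
     {KKinv a * KK a - 1 | a. True} \<union>
     {KK a * EE b * KKinv a - scal (qq powi (kdelta a b - kdelta a (b + 1))) (EE b) | a b. True} \<union>
     {KK a * FF b * KKinv a - scal (qq powi (kdelta a (b + 1) - kdelta a b)) (FF b) | a b. True} \<union>
     {EE a * FF b - FF b * EE a
        - scal (of_int (kdelta a b) / (qq - inverse qq)) (KK2 a (a + 1) - KK2 (a + 1) a)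
      | a b. True} \<union>
     {EE a * EE a * EE b + EE b * EE a * EE a - scal (qq + inverse qq) (EE a * EE b * EE a)
      | a b. \<bar>a - b\<bar> = 1} \<union>
     {EE a * EE b - EE b * EE a | a b. \<bar>a - b\<bar> > 1} \<union>
     {FF a * FF a * FF b + FF b * FF a * FF a - scal (qq + inverse qq) (FF a * FF b * FF a)
      | a b. \<bar>a - b\<bar> = 1} \<union>
     {FF a * FF b - FF b * FF a | a b. \<bar>a - b\<bar> > 1}"

inductive_set two_sided_ideal :: "'a::ring_1 set \<Rightarrow> 'a set" for R where
  zero: "0 \<in> two_sided_ideal R"
| mult: "r \<in> R \<Longrightarrow> x * r * y \<in> two_sided_ideal R"
| add: "x \<in> two_sided_ideal R \<Longrightarrow> y \<in> two_sided_ideal R \<Longrightarrow> x + y \<in> two_sided_ideal R"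

abbreviation tens2 :: "uqfree \<Rightarrow> uqfree \<Rightarrow> uqfree2" where
  "tens2 \<equiv> tensor Pair"

definition uq2_eq :: "uqfree2 \<Rightarrow> uqfree2 \<Rightarrow> bool" where
  "uq2_eq x y \<longleftrightarrow>
     x - y \<in> two_sided_ideal ({tens2 r 1 | r. r \<in> uq_rels} \<union> {tens2 1 r | r. r \<in> uq_rels})"

fun comult_gen :: "uqgen \<Rightarrow> uqfree2" where
  "comult_gen (GE a) = tens2 1 (EE a) + tens2 (EE a) (KK2 (a + 1) a)"
| "comult_gen (GF a) = tens2 (FF a) 1 + tens2 (KK2 a (a + 1)) (FF a)"
| "comult_gen (GK a) = tens2 (KK a) (KK a)"
| "comult_gen (GKinv a) = tens2 (KKinv a) (KKinv a)"

definition comult :: "uqfree \<Rightarrow> uqfree2" where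
  "comult = linext (\<lambda>w. prod_list (map comult_gen (letters w)))"

fun bar_gen :: "uqgen \<Rightarrow> uqgen" where
  "bar_gen (GE a) = GE a"
| "bar_gen (GF a) = GF a"
| "bar_gen (GK a) = GKinv a"
| "bar_gen (GKinv a) = GK a"

definition antilinext :: "('i \<Rightarrow> ('j \<Rightarrow>\<^sub>0 qfield)) \<Rightarrow> ('i \<Rightarrow>\<^sub>0 qfield) \<Rightarrow> ('j \<Rightarrow>\<^sub>0 qfield)" where
  "antilinext \<phi> x = (\<Sum>i\<in>Poly_Mapping.keys x. scal (qbar (Poly_Mapping.lookup x i)) (\<phi> i))"

definition uq_bar :: "uqfree \<Rightarrow> uqfree" where
  "uq_bar = antilinext (\<lambda>w. basis (map_fmon bar_gen w))"

definition uq2_bar :: "uqfree2 \<Rightarrow> uqfree2" where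
  "uq2_bar = antilinext (\<lambda>(w, w'). basis (map_fmon bar_gen w, map_fmon bar_gen w'))"


section \<open>The quasi-R-matrix\<close>

text \<open>The root lattice is \<open>int \<Rightarrow>\<^sub>0 int\<close>, with simple roots \<open>Poly_Mapping.single a 1\<close>.\<close>

fun wt_gen :: "uqgen \<Rightarrow> (int \<Rightarrow>\<^sub>0 int)" where
  "wt_gen (GE a) = Poly_Mapping.single a 1"
| "wt_gen (GF a) = - Poly_Mapping.single a 1"
| "wt_gen (GK a) = 0"
| "wt_gen (GKinv a) = 0"

definition wt :: "uqgen fmon \<Rightarrow> (int \<Rightarrow>\<^sub>0 int)" where
  "wt w = sum_list (map wt_gen (letters w))"

definition sub_roots :: "nat \<Rightarrow> int set" where
  "sub_roots k = {- int k .. int k - 1}"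

definition sub_gens :: "nat \<Rightarrow> uqgen set" where
  "sub_gens k = (\<Union>a\<in>sub_roots k. {GE a, GF a, GK a, GKinv a, GK (a + 1), GKinv (a + 1)})"

definition Usub :: "nat \<Rightarrow> uqfree set" where
  "Usub k = {u. \<forall>w\<in>Poly_Mapping.keys u. set (letters w) \<subseteq> sub_gens k}"

definition pos_words :: "nat \<Rightarrow> (int \<Rightarrow>\<^sub>0 int) \<Rightarrow> uqgen fmon set" where
  "pos_words k \<mu> = {w. set (letters w) \<subseteq> GE ` sub_roots k \<and> wt w = \<mu>}"

definition neg_words :: "nat \<Rightarrow> (int \<Rightarrow>\<^sub>0 int) \<Rightarrow> uqgen fmon set" where
  "neg_words k \<mu> = {w. set (letters w) \<subseteq> GF ` sub_roots k \<and> wt w = \<mu>}"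

definition bicomp :: "(int \<Rightarrow>\<^sub>0 int) \<Rightarrow> (int \<Rightarrow>\<^sub>0 int) \<Rightarrow> uqfree2 \<Rightarrow> uqfree2" where
  "bicomp \<alpha> \<beta> = linext (\<lambda>(w, w'). if wt w = \<alpha> \<and> wt w' = \<beta> then basis (w, w') else 0)"

text \<open>The first conjunct says that \<open>\<Theta> \<mu>\<close> represents an element of the tensor product of the
  weight spaces \<open>\<mu>\<close> and \<open>- \<mu>\<close> of the positive and the negative part; it forces
  \<open>\<Theta> \<mu> = 0\<close> unless \<open>\<mu>\<close> is a sum of simple roots. The intertwining identity
  is one between formal infinite sums over \<open>\<mu>\<close>, that is, an identity in every bidegree
  \<open>(\<alpha>, \<beta>)\<close>; in a fixed bidegree only finitely many \<open>\<mu>\<close> contribute.\<close>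

definition quasi_R_matrix :: "nat \<Rightarrow> ((int \<Rightarrow>\<^sub>0 int) \<Rightarrow> uqfree2) \<Rightarrow> bool" where
  "quasi_R_matrix k \<Theta> \<longleftrightarrow>
     (\<forall>\<mu>. Poly_Mapping.keys (\<Theta> \<mu>) \<subseteq> pos_words k \<mu> \<times> neg_words k (- \<mu>)) \<and>
     \<Theta> 0 = tens2 1 1 \<and>
     (\<forall>u\<in>Usub k. \<forall>\<alpha> \<beta>.
        uq2_eq (Sum_any (\<lambda>\<mu>. bicomp \<alpha> \<beta> (comult u * \<Theta> \<mu>)))
               (Sum_any (\<lambda>\<mu>. bicomp \<alpha> \<beta> (\<Theta> \<mu> * uq2_bar (comult (uq_bar u))))))"


section \<open>Modules\<close>

text \<open>A module is given by the action of the generators on a basis. The action of an element of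
  U or \<open>U \<otimes> U\<close> is computed from a representative; on the modules below the defining
  relations hold, so the choice does not matter.\<close>

type_synonym 'i uqmod = "uqgen \<Rightarrow> 'i \<Rightarrow> ('i \<Rightarrow>\<^sub>0 qfield)"

definition word_act :: "'i uqmod \<Rightarrow> uqgen fmon \<Rightarrow> ('i \<Rightarrow>\<^sub>0 qfield) \<Rightarrow> ('i \<Rightarrow>\<^sub>0 qfield)" where
  "word_act \<rho> w x = foldr (\<lambda>g. linext (\<rho> g)) (letters w) x"

text \<open>The action of z on the pure tensor \<open>x \<otimes> y\<close>.\<close>

definition act2 ::
  "('i \<Rightarrow> 'j \<Rightarrow> 'l) \<Rightarrow> 'i uqmod \<Rightarrow> 'j uqmod \<Rightarrow> uqfree2 \<Rightarrow>
   ('i \<Rightarrow>\<^sub>0 qfield) \<Rightarrow> ('j \<Rightarrow>\<^sub>0 qfield) \<Rightarrow> ('l \<Rightarrow>\<^sub>0 qfield)" where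
  "act2 p \<rho> \<sigma> z x y =
     (\<Sum>(w, w')\<in>Poly_Mapping.keys z.
        scal (Poly_Mapping.lookup z (w, w')) (tensor p (word_act \<rho> w x) (word_act \<sigma> w' y)))"

text \<open>On the modules below only finitely many \<open>\<Theta> \<mu>\<close> act nontrivially on a given pure tensor.\<close>

definition Theta_act ::
  "('i \<Rightarrow> 'j \<Rightarrow> 'l) \<Rightarrow> 'i uqmod \<Rightarrow> 'j uqmod \<Rightarrow> ((int \<Rightarrow>\<^sub>0 int) \<Rightarrow> uqfree2) \<Rightarrow>
   ('i \<Rightarrow>\<^sub>0 qfield) \<Rightarrow> ('j \<Rightarrow>\<^sub>0 qfield) \<Rightarrow> ('l \<Rightarrow>\<^sub>0 qfield)" where
  "Theta_act p \<rho> \<sigma> \<Theta> x y = Sum_any (\<lambda>\<mu>. act2 p \<rho> \<sigma> (\<Theta> \<mu>) x y)"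

fun V_mod :: "int uqmod" where
  "V_mod (GK a) b = scal (qq powi kdelta a b) (basis b)"
| "V_mod (GKinv a) b = scal (qq powi (- kdelta a b)) (basis b)"
| "V_mod (GE a) b = (if b = a + 1 then basis a else 0)"
| "V_mod (GF a) b = (if b = a then basis (a + 1) else 0)"

fun W_mod :: "int uqmod" where
  "W_mod (GK a) b = scal (qq powi (- kdelta a b)) (basis b)"
| "W_mod (GKinv a) b = scal (qq powi kdelta a b) (basis b)"
| "W_mod (GE a) b = (if b = a then basis (a + 1) else 0)"
| "W_mod (GF a) b = (if b = a + 1 then basis a else 0)"

definition VW_mod :: "nat \<Rightarrow> int uqmod" where
  "VW_mod c = (if c = 0 then V_mod else W_mod)"

fun triv_mod :: "int list uqmod" where
  "triv_mod (GE a) f = 0"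
| "triv_mod (GF a) f = 0"
| "triv_mod (GK a) f = basis f"
| "triv_mod (GKinv a) f = basis f"

definition zero_one_seq :: "nat \<Rightarrow> nat \<Rightarrow> nat list \<Rightarrow> bool" where
  "zero_one_seq m n b \<longleftrightarrow> set b \<subseteq> {0, 1} \<and> count_list b 0 = m \<and> count_list b 1 = n"

abbreviation snoc :: "'a list \<Rightarrow> 'a \<Rightarrow> 'a list" where
  "snoc xs x \<equiv> xs @ [x]"

text \<open>\<open>T_mod b n\<close> is the tensor product of the first n factors of the Fock space of b; its
  standard basis is indexed by the integer lists of length n. The empty product is the trivial
  module, given by the counit.\<close>

primrec T_mod :: "nat list \<Rightarrow> nat \<Rightarrow> int list uqmod" where
  "T_mod b 0 = triv_mod"
| "T_mod b (Suc n) = (\<lambda>g f.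
     act2 snoc (T_mod b n) (VW_mod (b ! n)) (comult_gen g) (basis (butlast f)) (basis (last f)))"


section \<open>Infinite wedges\<close>

text \<open>Positions \<open>1, 2, \<dots>\<close> of infinite sequences, and of partitions, are shifted to
  \<open>0, 1, \<dots>\<close>.\<close>

definition Zinf_plus :: "(nat \<Rightarrow> int) set" where
  "Zinf_plus = {h. (\<forall>s t. s < t \<longrightarrow> h t < h s) \<and> (\<forall>\<^sub>F t in sequentially. h t = - int t)}"

definition Zinf_minus :: "(nat \<Rightarrow> int) set" where
  "Zinf_minus = {h. (\<forall>s t. s < t \<longrightarrow> h s < h t) \<and> (\<forall>\<^sub>F t in sequentially. h t = int t + 1)}"

definition Zinf :: "nat \<Rightarrow> (nat \<Rightarrow> int) set" where
  "Zinf \<epsilon> = (if \<epsilon> = 0 then Zinf_plus else Zinf_minus)"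

definition replace_val :: "int \<Rightarrow> int \<Rightarrow> (nat \<Rightarrow> int) \<Rightarrow> ((nat \<Rightarrow> int) \<Rightarrow>\<^sub>0 qfield)" where
  "replace_val c d h =
     (if c \<in> range h \<and> d \<notin> range h then basis (\<lambda>t. if h t = c then d else h t) else 0)"

fun wedgeV_mod :: "(nat \<Rightarrow> int) uqmod" where
  "wedgeV_mod (GE a) h = replace_val (a + 1) a h"
| "wedgeV_mod (GF a) h = replace_val a (a + 1) h"
| "wedgeV_mod (GK a) h = scal (qq powi int (card {t. h t = a})) (basis h)"
| "wedgeV_mod (GKinv a) h = scal (qq powi (- int (card {t. h t = a}))) (basis h)"

fun wedgeW_mod :: "(nat \<Rightarrow> int) uqmod" where
  "wedgeW_mod (GE a) h = replace_val a (a + 1) h"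
| "wedgeW_mod (GF a) h = replace_val (a + 1) a h"
| "wedgeW_mod (GK a) h = scal (qq powi (- int (card {t. h t = a}))) (basis h)"
| "wedgeW_mod (GKinv a) h = scal (qq powi int (card {t. h t = a})) (basis h)"

definition wedge_mod :: "nat \<Rightarrow> (nat \<Rightarrow> int) uqmod" where
  "wedge_mod \<epsilon> = (if \<epsilon> = 0 then wedgeV_mod else wedgeW_mod)"

definition partitions :: "(nat \<Rightarrow> nat) set" where
  "partitions = {p. (\<forall>s t. s \<le> t \<longrightarrow> p t \<le> p s) \<and> (\<forall>\<^sub>F t in sequentially. p t = 0)}"

definition conjugate :: "(nat \<Rightarrow> nat) \<Rightarrow> (nat \<Rightarrow> nat)" where
  "conjugate p = (\<lambda>t. card {s. t < p s})"

definition ket :: "(nat \<Rightarrow> nat) \<Rightarrow> (nat \<Rightarrow> int)" where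
  "ket p = (\<lambda>t. int (p t) - int t)"

definition ket_star :: "(nat \<Rightarrow> nat) \<Rightarrow> (nat \<Rightarrow> int)" where
  "ket_star p = (\<lambda>t. int t + 1 - int (p t))"

definition nat_index :: "(nat \<Rightarrow> int) \<Rightarrow> (nat \<Rightarrow> int)" where
  "nat_index h = ket_star (conjugate (the_inv_into partitions ket h))"

definition nat_wedge :: "((nat \<Rightarrow> int) \<Rightarrow>\<^sub>0 qfield) \<Rightarrow> ((nat \<Rightarrow> int) \<Rightarrow>\<^sub>0 qfield)" where
  "nat_wedge = linext (\<lambda>h. basis (nat_index h))"


section \<open>Standard bases, Bruhat orders, completions\<close>

type_synonym findex = "int list \<times> (nat \<Rightarrow> int)"

definition findices :: "nat list \<Rightarrow> nat \<Rightarrow> findex set" where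
  "findices b \<epsilon> = {(u, h). length u = length b \<and> h \<in> Zinf \<epsilon>}"

definition nat_b :: "(findex \<Rightarrow>\<^sub>0 qfield) \<Rightarrow> (findex \<Rightarrow>\<^sub>0 qfield)" where
  "nat_b = linext (\<lambda>(u, h). tensor Pair (basis u) (nat_wedge (basis h)))"

definition nat_f :: "findex \<Rightarrow> findex" where
  "nat_f f = (fst f, nat_index (snd f))"

definition sharp :: "nat list \<Rightarrow> int list \<Rightarrow> int \<Rightarrow> nat \<Rightarrow> int" where
  "sharp b f a j = (\<Sum>i | j \<le> i \<and> i < length b \<and> f ! i \<le> a. (- 1) ^ (b ! i))"

definition bruhat_fin :: "nat list \<Rightarrow> int list \<Rightarrow> int list \<Rightarrow> bool" where
  "bruhat_fin b g f \<longleftrightarrow>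
     (\<forall>a. \<forall>j < length b. sharp b g a j \<le> sharp b f a j) \<and> (\<forall>a. sharp b g a 0 = sharp b f a 0)"

definition truncate :: "nat \<Rightarrow> findex \<Rightarrow> int list" where
  "truncate N f = fst f @ map (snd f) [0..<N]"

definition bruhat :: "nat list \<Rightarrow> nat \<Rightarrow> findex \<Rightarrow> findex \<Rightarrow> bool" where
  "bruhat b \<epsilon> g f \<longleftrightarrow>
     (\<forall>\<^sub>F N in sequentially. bruhat_fin (b @ replicate N \<epsilon>) (truncate N g) (truncate N f))"

text \<open>A formal, possibly infinite linear combination of the standard basis is its coefficient
  function; \<open>std f\<close> is the standard basis element indexed by f.\<close>

definition std :: "findex \<Rightarrow> findex \<Rightarrow> qfield" where
  "std f = (\<lambda>g. if g = f then 1 else 0)"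

definition unitriangular_at :: "nat list \<Rightarrow> nat \<Rightarrow> findex \<Rightarrow> (findex \<Rightarrow> qfield) \<Rightarrow> bool" where
  "unitriangular_at b \<epsilon> f x \<longleftrightarrow>
     x f = 1 \<and> (\<forall>g. x g \<noteq> 0 \<longrightarrow> g \<in> findices b \<epsilon> \<and> bruhat b \<epsilon> g f)"

definition B_completion :: "nat list \<Rightarrow> nat \<Rightarrow> (findex \<Rightarrow> qfield) set" where
  "B_completion b \<epsilon> =
     {(\<lambda>g. \<Sum>x\<in>X. c x * x g) | X c.
        finite X \<and> (\<forall>x\<in>X. \<exists>f\<in>findices b \<epsilon>. unitriangular_at b \<epsilon> f x)}"

text \<open>The extension of \<open>nat_b\<close> to infinite sums: the coefficient of each standard basis element
  in the image is the sum of its coefficients in the images of the summands.\<close>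

definition nat_hat :: "(findex \<Rightarrow> qfield) \<Rightarrow> (findex \<Rightarrow> qfield)" where
  "nat_hat x = (\<lambda>g. Sum_any (\<lambda>f. x f * Poly_Mapping.lookup (nat_b (basis f)) g))"


section \<open>Bar maps\<close>

text \<open>\<open>psi_fin \<Theta> b n f\<close> is the image under \<open>\<psi>\<close> (for one fixed k with quasi-R-matrix \<open>\<Theta>\<close>) of
  the standard basis element f of the product of the first n factors.\<close>

primrec psi_fin ::
  "((int \<Rightarrow>\<^sub>0 int) \<Rightarrow> uqfree2) \<Rightarrow> nat list \<Rightarrow> nat \<Rightarrow> int list \<Rightarrow> (int list \<Rightarrow>\<^sub>0 qfield)" where
  "psi_fin \<Theta> b 0 f = basis f"
| "psi_fin \<Theta> b (Suc n) f =
     (if n = 0 then basis f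
      else Theta_act snoc (T_mod b n) (VW_mod (b ! n)) \<Theta>
             (psi_fin \<Theta> b n (butlast f)) (basis (last f)))"

definition psi ::
  "((int \<Rightarrow>\<^sub>0 int) \<Rightarrow> uqfree2) \<Rightarrow> nat list \<Rightarrow> nat \<Rightarrow> findex \<Rightarrow> (findex \<Rightarrow>\<^sub>0 qfield)" where
  "psi \<Theta> b \<epsilon> f =
     (if b = [] then basis f
      else Theta_act Pair (T_mod b (length b)) (wedge_mod \<epsilon>) \<Theta>
             (psi_fin \<Theta> b (length b) (fst f)) (basis (snd f)))"

definition bar_coeff ::
  "(nat \<Rightarrow> (int \<Rightarrow>\<^sub>0 int) \<Rightarrow> uqfree2) \<Rightarrow> nat list \<Rightarrow> nat \<Rightarrow> findex \<Rightarrow> findex \<Rightarrow> qfield" where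
  "bar_coeff \<Theta> b \<epsilon> g f =
     (THE c. \<forall>\<^sub>F l in sequentially. Poly_Mapping.lookup (psi (\<Theta> l) b \<epsilon> f) g = c)"

text \<open>Anti-linear extension to infinite sums, coefficient by coefficient; for elements of the
  completion only finitely many summands are nonzero because Bruhat intervals are finite.\<close>

definition bar_map ::
  "(nat \<Rightarrow> (int \<Rightarrow>\<^sub>0 int) \<Rightarrow> uqfree2) \<Rightarrow> nat list \<Rightarrow> nat \<Rightarrow> (findex \<Rightarrow> qfield) \<Rightarrow> (findex \<Rightarrow> qfield)"
  where
  "bar_map \<Theta> b \<epsilon> x = (\<lambda>g. Sum_any (\<lambda>f. qbar (x f) * bar_coeff \<Theta> b \<epsilon> g f))"


section \<open>Canonical and dual canonical bases\<close>

definition bar_invariant_basis ::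
  "qfield set \<Rightarrow> (nat \<Rightarrow> (int \<Rightarrow>\<^sub>0 int) \<Rightarrow> uqfree2) \<Rightarrow> nat list \<Rightarrow> nat \<Rightarrow>
   (findex \<Rightarrow> findex \<Rightarrow> qfield) \<Rightarrow> bool" where
  "bar_invariant_basis R \<Theta> b \<epsilon> X \<longleftrightarrow>
     (\<forall>f\<in>findices b \<epsilon>.
        X f \<in> B_completion b \<epsilon> \<and> bar_map \<Theta> b \<epsilon> (X f) = X f \<and>
        unitriangular_at b \<epsilon> f (X f) \<and>
        (\<forall>g\<in>findices b \<epsilon>. bruhat b \<epsilon> g f \<and> g \<noteq> f \<longrightarrow> X f g \<in> R))"

text \<open>The coefficients \<open>t\<^sub>g\<^sub>f\<close> and \<open>l\<^sub>g\<^sub>f\<close> are \<open>T f g\<close> and \<open>L f g\<close>.\<close>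

abbreviation canonical_basis ::
  "(nat \<Rightarrow> (int \<Rightarrow>\<^sub>0 int) \<Rightarrow> uqfree2) \<Rightarrow> nat list \<Rightarrow> nat \<Rightarrow>
   (findex \<Rightarrow> findex \<Rightarrow> qfield) \<Rightarrow> bool" where
  "canonical_basis \<Theta> b \<epsilon> T \<equiv> bar_invariant_basis q_Zq \<Theta> b \<epsilon> T"

abbreviation dual_canonical_basis ::
  "(nat \<Rightarrow> (int \<Rightarrow>\<^sub>0 int) \<Rightarrow> uqfree2) \<Rightarrow> nat list \<Rightarrow> nat \<Rightarrow>
   (findex \<Rightarrow> findex \<Rightarrow> qfield) \<Rightarrow> bool" where
  "dual_canonical_basis \<Theta> b \<epsilon> L \<equiv> bar_invariant_basis qinv_Zqinv \<Theta> b \<epsilon> L"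

end

theory Submission
  imports Defs
begin

text \<open>The increasing sequence \<open>nat_index h\<close> enumerates the complement of the values of h. Measuring a
  wedge of either kind by the numbers of its entries above a (first kind) or up to a (second kind),
  the two depth functions of h and \<open>nat_index h\<close> differ by a, both Bruhat orders are expressed
  by the same inequalities between depths, and every \<open>F\<^sub>a\<close> acts on both kinds by raising the depth
  at a. Since the second tensor components of the quasi-R-matrix involve only the generators
  \<open>F\<^sub>a\<close>, its action, and hence the bar map, commutes with the isomorphism. The bases then
  correspond by uniqueness: weights force the bar map to be unitriangular, Bruhat intervals are
  finite, and at a maximal index where two candidates differ the difference of their coefficients
  is fixed by the bar automorphism, hence zero.\<close>

section \<open>The bar automorphism of the coefficient field\<close>

text \<open>Conjugating a partition rearranges the positions of its wedge globally, so the two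
  Bruhat orders cannot be compared position by position. Counting entries by value removes the
  obstacle: every condition at a position inside the wedge becomes one inequality between depths.
  The isomorphism is not linear over the whole quantum group: \<open>K_a\<close> acts on a wedge and
  on its image with eigenvalues that differ by a factor q. The bar map never meets this discrepancy,
  because the quasi-R-matrix applies its positive half to the finite part, which both sides share.
  Unitriangularity comes from a cancellation in \<open>sharp_inf\<close>: a component of weight
  \<mu> raises the finite part by at most \<mu> at every position and the depth by exactly \<mu>, so
  the difference can only decrease, and only \<mu> = 0 contributes to the diagonal. The uniqueness
  argument runs on the side of increasing wedges; a basis of the other side is carried over before
  it is compared.\<close>

abbreviation qconst :: "rat \<Rightarrow> qfield" where
  "qconst c \<equiv> to_fract [:c:]"

lemma qconst_add: "qconst (a + b) = qconst a + qconst b"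
  by (simp flip: to_fract_add)

lemma qconst_mult: "qconst (a * b) = qconst a * qconst b"
  by (simp flip: to_fract_mult)

lemma qq_nonzero [simp]: "qq \<noteq> 0"
  by (simp add: qq_def)

section \<open>Evaluation of rational polynomials in the field\<close>

lemma poly_map_qconst_pCons:
  "poly (map_poly qconst (pCons a p)) x = qconst a + x * poly (map_poly qconst p) x"
  by (simp add: map_poly_pCons)

lemma poly_map_qconst_add:
  "poly (map_poly qconst (p + r)) x = poly (map_poly qconst p) x + poly (map_poly qconst r) x"
  by (induction p r rule: poly_induct2)
     (simp_all add: poly_map_qconst_pCons qconst_add algebra_simps del: to_fract_add)

lemma poly_map_qconst_smult:
  "poly (map_poly qconst (smult c p)) x = qconst c * poly (map_poly qconst p) x"
  by (induction p)
     (simp_all add: poly_map_qconst_pCons qconst_mult algebra_simps del: to_fract_mult)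

lemma poly_map_qconst_mult:
  "poly (map_poly qconst (p * r)) x = poly (map_poly qconst p) x * poly (map_poly qconst r) x"
  by (induction p)
     (simp_all add: poly_map_qconst_pCons poly_map_qconst_add poly_map_qconst_smult algebra_simps)

lemma poly_map_qconst_qq: "poly (map_poly qconst p) qq = to_fract p"
proof (induction p)
  case (pCons a p)
  have "to_fract (pCons a p) = to_fract ([:a:] + [:0, 1:] * p)"
    by simp
  also have "\<dots> = qconst a + qq * to_fract p"
    by (simp only: to_fract_add to_fract_mult qq_def)
  finally show ?case
    using pCons by (simp add: poly_map_qconst_pCons)
qed simp

text \<open>The sets \<open>q_Zq\<close> and \<open>qinv_Zqinv\<close> cast integer coefficients
  straight into the field. Routing the cast through the rationals lets their elements be written
  with \<open>to_fract\<close> and \<open>eval_at_inv\<close>.\<close>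

lemma poly_map_of_int_qconst:
  "poly (map_poly of_int p) (x :: qfield) = poly (map_poly qconst (map_poly of_int p)) x"
proof (induction p)
  case (pCons a p)
  have "(of_int a :: qfield) = qconst (of_int a)"
  proof (induction a rule: int_induct[where k = 0])
    case (step1 i)
    then show ?case by (simp add: qconst_add one_pCons[symmetric] del: to_fract_add)
  next
    case (step2 i)
    have "qconst (of_int i) = qconst (of_int (i - 1)) + qconst 1"
      by (simp flip: qconst_add)
    with step2 show ?case by (simp add: one_pCons[symmetric])
  qed simp
  with pCons show ?case by (simp add: map_poly_pCons)
qed simp

lemma eval_at_inv_pCons: "eval_at_inv (pCons a p) = qconst a + inverse qq * eval_at_inv p"
  by (simp add: eval_at_inv_def poly_map_qconst_pCons)

lemma eval_at_inv_add: "eval_at_inv (p + r) = eval_at_inv p + eval_at_inv r"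
  and eval_at_inv_mult: "eval_at_inv (p * r) = eval_at_inv p * eval_at_inv r"
  and eval_at_inv_0 [simp]: "eval_at_inv 0 = 0"
  and eval_at_inv_1 [simp]: "eval_at_inv 1 = 1"
  by (simp_all add: eval_at_inv_def poly_map_qconst_add poly_map_qconst_mult map_poly_pCons
      flip: one_pCons)

text \<open>The power of q clears all denominators of p(1/q) and reverses the coefficients. This
  yields both the injectivity of \<open>eval_at_inv\<close> and, later, a degree bound.\<close>

lemma to_fract_reflect_poly: "to_fract (reflect_poly p) = qq ^ degree p * eval_at_inv p"
proof -
  have deg: "degree (map_poly qconst p) = degree p"
    by (rule degree_map_poly) simp
  have "reflect_poly (map_poly qconst p) = map_poly qconst (reflect_poly p)"
    by (rule poly_eqI) (simp add: coeff_reflect_poly deg coeff_map_poly)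
  with poly_reflect_poly_nz[of qq "map_poly qconst p"] show ?thesis
    by (simp add: deg poly_map_qconst_qq eval_at_inv_def)
qed

lemma eval_at_inv_diff: "eval_at_inv (p - r) = eval_at_inv p - eval_at_inv r"
  using eval_at_inv_add[of "p - r" r] by simp

lemma eval_at_inv_eq_0_iff [simp]: "eval_at_inv p = 0 \<longleftrightarrow> p = 0"
  using to_fract_reflect_poly[of p] by auto

text \<open>The definite description in \<open>qbar\<close> is meaningful because equal fractions
  cross-multiply to equal polynomials, while \<open>eval_at_inv\<close> preserves products and
  nonzero elements.\<close>

lemma qbar_quotient:
  assumes "r \<noteq> 0"
  shows "qbar (to_fract p / to_fract r) = eval_at_inv p / eval_at_inv r"
  unfolding qbar_def
proof (rule the_equality)
  show "\<exists>p' r'. r' \<noteq> 0 \<and> to_fract p / to_fract r = to_fract p' / to_fract r' \<and>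
      eval_at_inv p / eval_at_inv r = eval_at_inv p' / eval_at_inv r'"
    using assms by blast
next
  fix y
  assume "\<exists>p' r'. r' \<noteq> 0 \<and> to_fract p / to_fract r = to_fract p' / to_fract r' \<and>
      y = eval_at_inv p' / eval_at_inv r'"
  then obtain p' r' where *: "r' \<noteq> 0" "to_fract p / to_fract r = to_fract p' / to_fract r'"
      "y = eval_at_inv p' / eval_at_inv r'"
    by blast
  then have "to_fract (p * r') = to_fract (p' * r)"
    using assms by (simp add: frac_eq_eq)
  then have "eval_at_inv (p * r') = eval_at_inv (p' * r)"
    by (simp only: to_fract_eq_iff)
  then show "y = eval_at_inv p / eval_at_inv r"
    using * assms by (simp add: frac_eq_eq eval_at_inv_mult)
qed

lemma qfield_quotientE:
  fixes x :: qfield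
  obtains p r where "r \<noteq> 0" "x = to_fract p / to_fract r"
  by (metis Fract_cases Fract_conv_to_fract)

section \<open>The bar automorphism and the field operations\<close>

lemma qbar_add: "qbar (x + y) = qbar x + qbar y"
proof -
  obtain p r p' r' where "r \<noteq> 0" "x = to_fract p / to_fract r"
      "r' \<noteq> 0" "y = to_fract p' / to_fract r'"
    by (metis qfield_quotientE)
  moreover from this have "x + y = to_fract (p * r' + p' * r) / to_fract (r * r')"
    by (simp add: add_frac_eq)
  ultimately show ?thesis
    by (simp only: qbar_quotient eval_at_inv_add eval_at_inv_mult mult_eq_0_iff
        add_frac_eq eval_at_inv_eq_0_iff simp_thms not_False_eq_True)
qed

lemma qbar_mult: "qbar (x * y) = qbar x * qbar y"
proof -
  obtain p r p' r' where "r \<noteq> 0" "x = to_fract p / to_fract r"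
      "r' \<noteq> 0" "y = to_fract p' / to_fract r'"
    by (metis qfield_quotientE)
  moreover from this have "x * y = to_fract (p * p') / to_fract (r * r')"
    by simp
  ultimately show ?thesis
    by (simp only: qbar_quotient eval_at_inv_mult mult_eq_0_iff times_divide_times_eq simp_thms)
qed

lemma qbar_to_fract: "qbar (to_fract p) = eval_at_inv p"
  using qbar_quotient[of 1 p] by simp

lemma qbar_0 [simp]: "qbar 0 = 0"
  using qbar_to_fract[of 0] by simp

lemma qbar_1 [simp]: "qbar 1 = 1"
  using qbar_to_fract[of 1] by simp

lemma qbar_qq [simp]: "qbar qq = inverse qq"
proof -
  have "qbar (to_fract [:0, 1:]) = inverse qq"
    by (simp add: qbar_to_fract eval_at_inv_pCons flip: one_pCons)
  then show ?thesis
    by (simp add: qq_def)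
qed

lemma qbar_inverse_qq [simp]: "qbar (inverse qq) = qq"
proof -
  have "qbar (inverse qq) * inverse qq = 1"
    by (metis left_inverse qbar_1 qbar_mult qbar_qq qq_nonzero)
  then show ?thesis
    by (simp add: field_simps)
qed

lemma qbar_qconst [simp]: "qbar (qconst c) = qconst c"
  by (simp add: qbar_to_fract eval_at_inv_pCons)

lemma qbar_eval_at_inv: "qbar (eval_at_inv p) = to_fract p"
proof (induction p)
  case (pCons a p)
  then show ?case
    by (simp add: eval_at_inv_pCons qbar_add qbar_mult poly_map_qconst_pCons
        flip: poly_map_qconst_qq[of "pCons a p"])
       (simp add: poly_map_qconst_qq)
qed simp

text \<open>One side has only positive powers of q and the other only negative ones. After clearing
  denominators this becomes a contradiction between degrees.\<close>

lemma q_to_fract_eq_imp_0: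
  assumes "qq * to_fract p = inverse qq * eval_at_inv p"
  shows "p = 0"
proof (rule ccontr)
  assume "p \<noteq> 0"
  \<comment> \<open>Both sides are multiplied by q to the power \<open>degree p + 1\<close>: the
    factor \<open>qq ^ degree p\<close> clears \<open>eval_at_inv p\<close>, the extra q cancels
    \<open>inverse qq\<close>. The left side then has degree \<open>2 * degree p + 2\<close>, the
    right side at most \<open>degree p\<close>.\<close>
  have "qq ^ degree p * (qq * (qq * to_fract p)) = to_fract (reflect_poly p)"
    unfolding assms to_fract_reflect_poly by (simp add: field_simps)
  moreover have "qq ^ d = to_fract (monom 1 d)" for d
  proof (induction d)
    case (Suc d)
    have "(monom 1 (Suc d) :: rat poly) = [:0, 1:] * monom 1 d"
      by (simp add: monom_Suc)
    then have "to_fract (monom 1 (Suc d)) = qq * to_fract (monom 1 d)"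
      by (simp only: to_fract_mult qq_def)
    with Suc show ?case by simp
  qed (simp flip: one_pCons)
  then have "qq ^ degree p * (qq * (qq * to_fract p)) = to_fract (monom 1 (degree p + 2) * p)"
    by (simp add: algebra_simps flip: power_Suc power_add)
       (metis power_Suc mult.assoc mult.commute)
  ultimately have "monom 1 (degree p + 2) * p = reflect_poly p"
    by (metis to_fract_eq_iff)
  moreover have "degree (monom 1 (degree p + 2) * p) = degree p + 2 + degree p"
    using \<open>p \<noteq> 0\<close> by (simp add: degree_mult_eq degree_monom_eq)
  ultimately show False
    using degree_reflect_poly_le[of p] by simp
qed

text \<open>The last assumption is what comparing coefficients of two bar-invariant elements
  produces: the bar fixes x - y, a multiple of q by a polynomial in q.\<close>

lemma q_Zq_qbar_unique:
  assumes "x \<in> q_Zq" "y \<in> q_Zq" "x - y = qbar x - qbar y"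
  shows "x = y"
proof -
  obtain p r where x: "x = qq * to_fract p" and y: "y = qq * to_fract r"
    using assms(1,2) by (auto simp: q_Zq_def poly_map_of_int_qconst poly_map_qconst_qq)
  have "qq * to_fract (p - r) = inverse qq * eval_at_inv (p - r)"
    using assms(3) by (simp add: x y qbar_mult qbar_to_fract eval_at_inv_diff algebra_simps)
  then show ?thesis
    using q_to_fract_eq_imp_0 x y by fastforce
qed

lemma qinv_Zqinv_qbar_unique:
  assumes "x \<in> qinv_Zqinv" "y \<in> qinv_Zqinv" "x - y = qbar x - qbar y"
  shows "x = y"
proof -
  obtain p r where x: "x = inverse qq * eval_at_inv p" and y: "y = inverse qq * eval_at_inv r"
    using assms(1,2) by (auto simp: qinv_Zqinv_def poly_map_of_int_qconst eval_at_inv_def)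
  \<comment> \<open>For negative powers the bar exchanges the two sides, so the same equation
    appears, read backwards.\<close>
  have "qq * to_fract (p - r) = inverse qq * eval_at_inv (p - r)"
    using assms(3) by (simp add: x y qbar_mult qbar_eval_at_inv eval_at_inv_diff algebra_simps)
  then show ?thesis
    using q_to_fract_eq_imp_0 x y by fastforce
qed


section \<open>Finitely supported vectors\<close>

lemma lookup_scal [simp]: "Poly_Mapping.lookup (scal c x) i = c * Poly_Mapping.lookup x i"
  by (simp add: scal_def Poly_Mapping.map.rep_eq when_def)

lemma scal_0_left [simp]: "scal 0 x = 0"
  and scal_1 [simp]: "scal 1 x = x"
  and scal_scal [simp]: "scal c (scal d x) = scal (c * d) x"
  and scal_add_left: "scal (c + d) x = scal c x + scal d x"
  by (rule poly_mapping_eqI; simp add: lookup_add algebra_simps)+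

lemma scal_sum: "scal c (sum \<phi> A) = (\<Sum>i\<in>A. scal c (\<phi> i))"
  by (rule poly_mapping_eqI) (simp add: lookup_sum sum_distrib_left)

lemma keys_scal_subset: "Poly_Mapping.keys (scal c x) \<subseteq> Poly_Mapping.keys x"
  by (auto simp: in_keys_iff)

lemma linext_superset:
  assumes "finite A" "Poly_Mapping.keys x \<subseteq> A"
  shows "linext \<phi> x = (\<Sum>i\<in>A. scal (Poly_Mapping.lookup x i) (\<phi> i))"
  unfolding linext_def using assms
  by (intro sum.mono_neutral_left) (auto simp: in_keys_iff)

lemma linext_0 [simp]: "linext \<phi> 0 = 0"
  by (simp add: linext_def)

lemma linext_single [simp]: "linext \<phi> (Poly_Mapping.single i c) = scal c (\<phi> i)"
  by (subst linext_superset[of "{i}"]) auto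

lemma linext_add: "linext \<phi> (x + y) = linext \<phi> x + linext \<phi> y"
proof -
  let ?A = "Poly_Mapping.keys x \<union> Poly_Mapping.keys y"
  have "Poly_Mapping.keys (x + y) \<subseteq> ?A"
    by (rule Poly_Mapping.keys_add)
  then show ?thesis
    by (simp add: linext_superset[of ?A] lookup_add scal_add_left sum.distrib)
qed

lemma linext_scal: "linext \<phi> (scal c x) = scal c (linext \<phi> x)"
  by (simp add: linext_superset[of "Poly_Mapping.keys x"] keys_scal_subset scal_sum)

lemma linext_sum: "linext \<phi> (sum \<psi> A) = (\<Sum>i\<in>A. linext \<phi> (\<psi> i))"
  by (induction A rule: infinite_finite_induct) (simp_all add: linext_add)

lemma linext_cong:
  "x = y \<Longrightarrow> (\<And>i. i \<in> Poly_Mapping.keys y \<Longrightarrow> \<phi> i = \<psi> i) \<Longrightarrow> linext \<phi> x = linext \<psi> y"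
  by (simp add: linext_def)

lemma linext_linext: "linext \<phi> (linext \<psi> x) = linext (\<lambda>i. linext \<phi> (\<psi> i)) x"
  unfolding linext_def[of \<psi>] linext_sum linext_scal by (simp add: linext_def)

section \<open>Supports of vectors\<close>

lemma keys_sum_subset:
  "Poly_Mapping.keys (sum \<phi> A) \<subseteq> (\<Union>i\<in>A. Poly_Mapping.keys (\<phi> i))"
proof (induction A rule: infinite_finite_induct)
  case (insert a A)
  then show ?case
    using Poly_Mapping.keys_add[of "\<phi> a" "sum \<phi> A"] by simp blast
qed simp_all

lemma keys_sumE:
  assumes "j \<in> Poly_Mapping.keys (sum \<phi> A)"
  obtains i where "i \<in> A" "j \<in> Poly_Mapping.keys (\<phi> i)"
proof -
  have "j \<in> (\<Union>i\<in>A. Poly_Mapping.keys (\<phi> i))"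
    by (rule subsetD[OF keys_sum_subset assms])
  then show ?thesis
    by (auto intro: that)
qed

lemma keys_linextE:
  assumes "j \<in> Poly_Mapping.keys (linext \<phi> x)"
  obtains i where "i \<in> Poly_Mapping.keys x" "j \<in> Poly_Mapping.keys (\<phi> i)"
proof -
  obtain i where "i \<in> Poly_Mapping.keys x"
      "j \<in> Poly_Mapping.keys (scal (Poly_Mapping.lookup x i) (\<phi> i))"
    using assms unfolding linext_def by (rule keys_sumE)
  then show ?thesis
    by (intro that) (auto simp: in_keys_iff)
qed

lemma keys_Sum_anyE:
  assumes "j \<in> Poly_Mapping.keys (Sum_any \<phi>)"
  obtains i where "j \<in> Poly_Mapping.keys (\<phi> i)"
  using assms unfolding Sum_any.expand_set by (rule keys_sumE) (rule that)

text \<open>Finiteness matters because \<open>Sum_any\<close> is zero on an infinite support,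
  whereas the images under a linear map might have a finite one.\<close>

lemma linext_Sum_any:
  assumes "finite {i. \<psi> i \<noteq> 0}"
  shows "linext \<phi> (Sum_any \<psi>) = Sum_any (\<lambda>i. linext \<phi> (\<psi> i))"
proof -
  have "Sum_any (\<lambda>i. linext \<phi> (\<psi> i)) = (\<Sum>i | \<psi> i \<noteq> 0. linext \<phi> (\<psi> i))"
    using assms by (intro Sum_any.expand_superset) auto
  then show ?thesis
    by (simp add: Sum_any.expand_set linext_sum)
qed

lemma linext_tensor: "linext \<phi> (tensor p x y) = linext (\<lambda>i. linext (\<lambda>j. \<phi> (p i j)) y) x"
  by (simp add: tensor_def linext_linext)

lemma tensor_linext: "tensor p x (linext \<phi> y) = linext (\<lambda>i. linext (\<lambda>j. tensor p (basis i) (\<phi> j)) y) x"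
  by (simp add: tensor_def linext_linext)

lemma tensor_basis [simp]: "tensor p (basis i) (basis j) = basis (p i j)"
  by (simp add: tensor_def)

lemma keys_tensorE:
  assumes "l \<in> Poly_Mapping.keys (tensor p x y)"
  obtains i j where "i \<in> Poly_Mapping.keys x" "j \<in> Poly_Mapping.keys y" "l = p i j"
  using assms unfolding tensor_def by (auto elim!: keys_linextE split: if_splits)

lemma lookup_linext_basis_inj:
  assumes "inj_on \<phi> A" "Poly_Mapping.keys x \<subseteq> A" "i \<in> A"
  shows "Poly_Mapping.lookup (linext (\<lambda>i. basis (\<phi> i)) x) (\<phi> i) = Poly_Mapping.lookup x i"
proof -
  have "Poly_Mapping.lookup (linext (\<lambda>i. basis (\<phi> i)) x) (\<phi> i) =
      (\<Sum>j\<in>Poly_Mapping.keys x. if j = i then Poly_Mapping.lookup x i else 0)"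
    unfolding linext_def lookup_sum
  proof (rule sum.cong)
    fix j assume "j \<in> Poly_Mapping.keys x"
    then have "\<phi> j = \<phi> i \<longleftrightarrow> j = i"
      using assms inj_onD by fastforce
    then show "Poly_Mapping.lookup (scal (Poly_Mapping.lookup x j) (basis (\<phi> j))) (\<phi> i) =
        (if j = i then Poly_Mapping.lookup x i else 0)"
      by (simp add: lookup_single when_def)
  qed simp
  then show ?thesis
    by (simp add: in_keys_iff)
qed

lemma lookup_tensor_basis:
  assumes "inj (\<lambda>i. p i j)"
  shows "Poly_Mapping.lookup (tensor p x (basis j)) (p i j) = Poly_Mapping.lookup x i"
  using lookup_linext_basis_inj[OF assms subset_UNIV UNIV_I, of x i] by (simp add: tensor_def)

lemma word_act_Nil [simp]: "word_act \<rho> (FMon []) x = x"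
  and word_act_Cons [simp]:
    "word_act \<rho> (FMon (g # w)) x = linext (\<rho> g) (word_act \<rho> (FMon w) x)"
  by (simp_all add: word_act_def)

lemma keys_act2E:
  assumes "l \<in> Poly_Mapping.keys (act2 p \<rho> \<sigma> z x y)"
  obtains w w' i j where "(w, w') \<in> Poly_Mapping.keys z"
    "i \<in> Poly_Mapping.keys (word_act \<rho> w x)" "j \<in> Poly_Mapping.keys (word_act \<sigma> w' y)" "l = p i j"
proof -
  obtain u where u: "u \<in> Poly_Mapping.keys z" "l \<in> Poly_Mapping.keys (case u of (w, w') \<Rightarrow>
      scal (Poly_Mapping.lookup z (w, w')) (tensor p (word_act \<rho> w x) (word_act \<sigma> w' y)))"
    using assms unfolding act2_def by (rule keys_sumE)
  obtain w w' where "u = (w, w')"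
    by (cases u)
  with u have "l \<in> Poly_Mapping.keys (tensor p (word_act \<rho> w x) (word_act \<sigma> w' y))"
    by (auto simp: in_keys_iff)
  then show ?thesis
    using u(1) \<open>u = (w, w')\<close> by (auto elim!: keys_tensorE intro: that)
qed

lemma act2_basis:
  "act2 p \<rho> \<sigma> (basis (w, w')) x y = tensor p (word_act \<rho> w x) (word_act \<sigma> w' y)"
  by (simp add: act2_def)

lemma tens2_one: "tens2 1 1 = basis (FMon [], FMon [])"
proof -
  have one: "(1 :: uqfree) = basis (FMon [])"
    by (simp flip: single_one zero_fmon_def)
  show ?thesis
    unfolding one by (rule tensor_basis)
qed


section \<open>Depth functions\<close>

text \<open>Turns the cardinalities in \<open>depth\<close> and \<open>conjugate\<close> into
  thresholds: counting an initial segment is the same as knowing where it ends.\<close>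

lemma down_closed_eq_lessThan:
  fixes A :: "nat set"
  assumes "finite A" "\<And>s t. t \<in> A \<Longrightarrow> s < t \<Longrightarrow> s \<in> A"
  shows "A = {..<card A}"
proof (cases "A = {}")
  case False
  with assms(1) have "Max A \<in> A"
    by simp
  then have "A = {..Max A}"
    using Max_ge[OF assms(1)] assms(2)[of "Max A"] by (metis atMost_iff le_less set_eqI)
  then show ?thesis
    by (metis card_atMost lessThan_Suc_atMost)
qed simp

lemma nat_eqI_less: "(\<And>t. t < m \<longleftrightarrow> t < n) \<Longrightarrow> m = n" for m n :: nat
  by (metis linorder_neqE_nat less_irrefl)

text \<open>Chosen such that for both kinds of wedges every \<open>F\<^sub>a\<close> raises the depth at a by one, and only
  that depth.\<close>

definition depth :: "nat \<Rightarrow> (nat \<Rightarrow> int) \<Rightarrow> int \<Rightarrow> nat" where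
  "depth \<epsilon> h a = (if \<epsilon> = 0 then card {t. a < h t} else card {t. h t \<le> a})"

lemma Zinf_tail:
  assumes "h \<in> Zinf \<epsilon>"
  shows "\<exists>T. \<forall>t\<ge>T. h t = (if \<epsilon> = 0 then - int t else int t + 1)"
  using assms by (auto simp: Zinf_def Zinf_plus_def Zinf_minus_def eventually_sequentially
      split: if_splits)

lemma Zinf_mono:
  "h \<in> Zinf \<epsilon> \<Longrightarrow> s < t \<Longrightarrow> if \<epsilon> = 0 then h t < h s else h s < h t"
  by (simp add: Zinf_def Zinf_plus_def Zinf_minus_def split: if_splits)

lemma less_depth_iff:
  assumes "h \<in> Zinf \<epsilon>"
  shows "t < depth \<epsilon> h a \<longleftrightarrow> (if \<epsilon> = 0 then a < h t else h t \<le> a)"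
proof -
  let ?A = "{t. if \<epsilon> = 0 then a < h t else h t \<le> a}"
  obtain T where T: "\<And>t. T \<le> t \<Longrightarrow> h t = (if \<epsilon> = 0 then - int t else int t + 1)"
    using Zinf_tail[OF assms] by blast
  \<comment> \<open>Past T the entries are -t or t + 1, and each of a < -t and t + 1 \<le> a forces
    t < |a|.\<close>
  have "?A \<subseteq> {..<max T (nat \<bar>a\<bar>)}"
  proof
    fix t assume "t \<in> ?A"
    then show "t \<in> {..<max T (nat \<bar>a\<bar>)}"
      using T[of t] by (cases "T \<le> t") (auto split: if_splits)
  qed
  then have "finite ?A"
    by (rule finite_subset) simp
  moreover have "s \<in> ?A" if "t \<in> ?A" "s < t" for s t
    using Zinf_mono[OF assms that(2)] that(1) by (simp split: if_splits)
  ultimately have "?A = {..<card ?A}"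
    by (rule down_closed_eq_lessThan)
  moreover have "card ?A = depth \<epsilon> h a"
    by (simp add: depth_def)
  ultimately have "?A = {..<depth \<epsilon> h a}"
    by (rule trans[OF _ arg_cong])
  from eqset_imp_iff[OF this, of t] show ?thesis
    by simp
qed

lemma depth_inj:
  assumes "h \<in> Zinf \<epsilon>" "k \<in> Zinf \<epsilon>" "\<And>a. depth \<epsilon> h a = depth \<epsilon> k a"
  shows "h = k"
proof
  fix t
  have "(if \<epsilon> = 0 then a < h t else h t \<le> a) = (if \<epsilon> = 0 then a < k t else k t \<le> a)" for a
    using assms less_depth_iff by metis
  \<comment> \<open>The values themselves settle the condition with \<le>, their predecessors the
    strict one.\<close>
  from this[of "h t"] this[of "k t"] this[of "h t - 1"] this[of "k t - 1"]
  show "h t = k t"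
    by (auto split: if_splits)
qed

text \<open>Far from the origin the depth is that of the vacuum, whose values are all a \<le> 0 for
  the first kind and all a \<ge> 1 for the second. The radius R later bounds truncations and Bruhat
  intervals.\<close>

lemma depth_tail:
  assumes "h \<in> Zinf \<epsilon>"
  shows "\<exists>R. \<forall>a. R \<le> \<bar>a\<bar> \<longrightarrow> depth \<epsilon> h a = (if \<epsilon> = 0 then nat (- a) else nat a)"
proof -
  obtain T where T: "\<And>t. T \<le> t \<Longrightarrow> h t = (if \<epsilon> = 0 then - int t else int t + 1)"
    using Zinf_tail[OF assms] by blast
  have mono: "if \<epsilon> = 0 then h t < h s else h s < h t" if "s < t" for s t
    using Zinf_mono[OF assms that] .
  \<comment> \<open>The bound puts a beyond the first entry on one side, so that h cannot differ
    from the vacuum there, and beyond the entry at T on the other side, where the tail formula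
    decides.\<close>
  have "depth \<epsilon> h a = (if \<epsilon> = 0 then nat (- a) else nat a)"
    if a: "\<bar>h 0\<bar> + int T + 1 \<le> \<bar>a\<bar>" for a
  proof (rule nat_eqI_less)
    fix t
    show "t < depth \<epsilon> h a \<longleftrightarrow> t < (if \<epsilon> = 0 then nat (- a) else nat a)"
      unfolding less_depth_iff[OF assms]
      using a T[of t] T[of T] mono[of 0 t] mono[of t T]
      by (cases "t < T"; cases "t = 0") (auto split: if_splits)
  qed
  then show ?thesis
    by blast
qed

text \<open>The jumps of the depth function recover the set of values; complementarity of value sets
  will be read off from a relation between depths.\<close>

lemma depth_step:
  assumes "h \<in> Zinf \<epsilon>"
  shows "int (depth \<epsilon> h a) - int (depth \<epsilon> h (a - 1)) =
    (if a \<in> range h then if \<epsilon> = 0 then - 1 else 1 else 0)"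
proof (cases "a \<in> range h")
  case True
  then obtain t where t: "h t = a"
    by blast
  have mono: "if \<epsilon> = 0 then h t < h s else h s < h t" if "s < t" for s t
    using Zinf_mono[OF assms that] .
  have "depth \<epsilon> h a = (if \<epsilon> = 0 then t else Suc t)"
  proof (rule nat_eqI_less)
    fix s
    show "s < depth \<epsilon> h a \<longleftrightarrow> s < (if \<epsilon> = 0 then t else Suc t)"
      unfolding less_depth_iff[OF assms] using t mono[of s t] mono[of t s]
      by (cases s t rule: linorder_cases) (auto split: if_splits)
  qed
  moreover have "depth \<epsilon> h (a - 1) = (if \<epsilon> = 0 then Suc t else t)"
  proof (rule nat_eqI_less)
    fix s
    show "s < depth \<epsilon> h (a - 1) \<longleftrightarrow> s < (if \<epsilon> = 0 then Suc t else t)"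
      unfolding less_depth_iff[OF assms] using t mono[of s t] mono[of t s]
      by (cases s t rule: linorder_cases) (auto split: if_splits)
  qed
  ultimately show ?thesis
    using True by simp
next
  case False
  have "depth \<epsilon> h a = depth \<epsilon> h (a - 1)"
  proof (rule nat_eqI_less)
    fix t
    have "h t \<noteq> a"
      using False by blast
    then show "t < depth \<epsilon> h a \<longleftrightarrow> t < depth \<epsilon> h (a - 1)"
      unfolding less_depth_iff[OF assms] by auto
  qed
  then show ?thesis
    using False by simp
qed

section \<open>The action of \<open>F_a\<close> on wedges\<close>

definition F_source :: "nat \<Rightarrow> int \<Rightarrow> int" where
  "F_source \<epsilon> a = (if \<epsilon> = 0 then a else a + 1)"

definition F_target :: "nat \<Rightarrow> int \<Rightarrow> int" where
  "F_target \<epsilon> a = (if \<epsilon> = 0 then a + 1 else a)"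

lemma wedge_mod_GF: "wedge_mod \<epsilon> (GF a) h = replace_val (F_source \<epsilon> a) (F_target \<epsilon> a) h"
  by (simp add: wedge_mod_def F_source_def F_target_def)

text \<open>Source and target are adjacent integers, so moving an entry to a free target keeps the
  strict order, and only the threshold at a separates the old value from the new one.\<close>

lemma replaced_wedge:
  assumes "h \<in> Zinf \<epsilon>" "F_source \<epsilon> a \<in> range h" "F_target \<epsilon> a \<notin> range h"
  defines "h' \<equiv> \<lambda>t. if h t = F_source \<epsilon> a then F_target \<epsilon> a else h t"
  shows "h' \<in> Zinf \<epsilon>" and "depth \<epsilon> h' x = depth \<epsilon> h x + (if x = a then 1 else 0)"
proof -
  obtain t0 where t0: "h t0 = F_source \<epsilon> a"
    using assms(2) by auto
  have no_target: "h t \<noteq> F_target \<epsilon> a" for t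
    using assms(3) by (metis rangeI)
  obtain T where T: "\<And>t. T \<le> t \<Longrightarrow> h t = (if \<epsilon> = 0 then - int t else int t + 1)"
    using Zinf_tail[OF assms(1)] by blast
  have mono: "if \<epsilon> = 0 then h t < h s else h s < h t" if "s < t" for s t
    using Zinf_mono[OF assms(1) that] .
  have eq_t0: "h t = F_source \<epsilon> a \<longleftrightarrow> t = t0" for t
    using t0 mono[of t t0] mono[of t0 t] by (cases t t0 rule: linorder_cases) (auto split: if_splits)
  have mono': "if \<epsilon> = 0 then h' t < h' s else h' s < h' t" if "s < t" for s t
    using mono[OF that] no_target[of s] no_target[of t]
    by (auto simp: h'_def F_source_def F_target_def split: if_splits)
  have "h' t = h t" if "max T (Suc t0) \<le> t" for t
    using that eq_t0[of t] by (auto simp: h'_def)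
  then have "\<forall>t\<ge>max T (Suc t0). h' t = (if \<epsilon> = 0 then - int t else int t + 1)"
    using T by auto
  then have "\<exists>N. \<forall>t\<ge>N. h' t = (if \<epsilon> = 0 then - int t else int t + 1)"
    by blast
  then show Zinf: "h' \<in> Zinf \<epsilon>"
    using mono' by (auto simp: Zinf_def Zinf_plus_def Zinf_minus_def eventually_sequentially
        split: if_splits)
  show "depth \<epsilon> h' x = depth \<epsilon> h x + (if x = a then 1 else 0)"
  proof (cases "x = a")
    case False
    have "t < depth \<epsilon> h' x \<longleftrightarrow> t < depth \<epsilon> h x" for t
      unfolding less_depth_iff[OF Zinf] less_depth_iff[OF assms(1)]
      using False by (auto simp: h'_def F_source_def F_target_def)
    then show ?thesis
      using False by (simp add: nat_eqI_less)
  next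
    case True
    \<comment> \<open>The moved entry sits exactly at the threshold: the positions before t0 are
      counted both before and after the move, t0 only after it.\<close>
    have 1: "t < depth \<epsilon> h a \<longleftrightarrow> t < t0" for t
      unfolding less_depth_iff[OF assms(1)]
      using t0 no_target[of t] mono[of t t0] mono[of t0 t]
      by (cases t t0 rule: linorder_cases) (auto simp: F_source_def F_target_def split: if_splits)
    have 2: "t < depth \<epsilon> h' a \<longleftrightarrow> t < Suc t0" for t
      unfolding less_depth_iff[OF Zinf]
      using t0 no_target[of t] mono[of t t0] mono[of t0 t]
      by (cases t t0 rule: linorder_cases)
         (auto simp: h'_def F_source_def F_target_def split: if_splits)
    from nat_eqI_less[of "depth \<epsilon> h a" t0, OF 1] nat_eqI_less[of "depth \<epsilon> h' a" "Suc t0", OF 2] True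
    show ?thesis by simp
  qed
qed


section \<open>The bijection between the two kinds of wedges\<close>

text \<open>Both inequalities say that the cell in row s and column t lies in the Young diagram of
  p. Monotonicity makes each column an initial segment, so its cardinality acts as a
  threshold.\<close>

lemma less_conjugate_iff:
  assumes "p \<in> partitions"
  shows "s < conjugate p t \<longleftrightarrow> t < p s"
proof -
  obtain T where T: "\<And>s. T \<le> s \<Longrightarrow> p s = 0"
    using assms by (auto simp: partitions_def eventually_sequentially)
  then have "{s. t < p s} \<subseteq> {..<T}"
    by (auto simp: not_le[symmetric] intro: ccontr)
  then have "finite {s. t < p s}"
    by (rule finite_subset) simp
  moreover have "\<And>s s'. s' \<in> {s. t < p s} \<Longrightarrow> s < s' \<Longrightarrow> s \<in> {s. t < p s}"
    using assms by (auto simp: partitions_def intro: less_le_trans)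
  ultimately have "{s. t < p s} = {..<conjugate p t}"
    unfolding conjugate_def by (rule down_closed_eq_lessThan)
  then show ?thesis
    by blast
qed

lemma conjugate_partitions:
  assumes "p \<in> partitions"
  shows "conjugate p \<in> partitions"
proof -
  have "conjugate p t \<le> conjugate p s" if "s \<le> t" for s t
  proof (rule ccontr)
    assume "\<not> conjugate p t \<le> conjugate p s"
    then have "t < p (conjugate p s)" "\<not> s < p (conjugate p s)"
      using less_conjugate_iff[OF assms, of "conjugate p s" t]
        less_conjugate_iff[OF assms, of "conjugate p s" s] by auto
    with that show False by simp
  qed
  moreover have "conjugate p t = 0" if "p 0 \<le> t" for t
    using less_conjugate_iff[OF assms, of 0 t] that by simp
  ultimately show ?thesis
    by (auto simp: partitions_def eventually_sequentially)
qed

lemma conjugate_conjugate: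
  assumes "p \<in> partitions"
  shows "conjugate (conjugate p) = p"
proof
  fix t
  show "conjugate (conjugate p) t = p t"
    by (rule nat_eqI_less) (simp add: less_conjugate_iff conjugate_partitions assms)
qed

text \<open>A strictly decreasing integer sequence drops by at least one at each step; adding the
  position back gives the weakly decreasing parts of a partition.\<close>

lemma decreasing_Zinf_plus_shift:
  assumes "h \<in> Zinf_plus" "s \<le> t"
  shows "h t + int t \<le> h s + int s"
  using assms(2)
proof (induction t rule: dec_induct)
  case (step t)
  have "h (Suc t) < h t"
    using assms(1) by (simp add: Zinf_plus_def)
  with step show ?case by simp
qed simp

lemma increasing_Zinf_minus_shift:
  assumes "h \<in> Zinf_minus" "s \<le> t"
  shows "h s - int s \<le> h t - int t"
  using assms(2)
proof (induction t rule: dec_induct)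
  case (step t)
  have "h t < h (Suc t)"
    using assms(1) by (simp add: Zinf_minus_def)
  with step show ?case by simp
qed simp

lemma ket_bij: "bij_betw ket partitions Zinf_plus"
proof (rule bij_betw_imageI)
  show "inj_on ket partitions"
    by (rule inj_onI) (auto simp: ket_def fun_eq_iff)
  have "ket p \<in> Zinf_plus" if p: "p \<in> partitions" for p
  proof -
    have "p t \<le> p s" if "s < t" for s t
      using p that by (auto simp: partitions_def)
    then have "ket p t < ket p s" if "s < t" for s t
      using that by (fastforce simp: ket_def)
    moreover have "\<forall>\<^sub>F t in sequentially. p t = 0"
      using p by (simp add: partitions_def)
    then have "\<forall>\<^sub>F t in sequentially. ket p t = - int t"
      by eventually_elim (simp add: ket_def)
    ultimately show ?thesis
      by (simp add: Zinf_plus_def)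
  qed
  moreover have "h \<in> ket ` partitions" if h: "h \<in> Zinf_plus" for h
  proof
    define p where "p t = nat (h t + int t)" for t
    obtain T where T: "\<And>t. T \<le> t \<Longrightarrow> h t = - int t"
      using h by (auto simp: Zinf_plus_def eventually_sequentially)
    \<comment> \<open>The shifted entries decrease weakly to the tail, where they vanish; hence
      \<open>nat\<close> loses nothing.\<close>
    have "0 \<le> h t + int t" for t
      using decreasing_Zinf_plus_shift[OF h, of t "max T t"] T[of "max T t"] by simp
    then show "h = ket p"
      by (auto simp: ket_def p_def)
    show "p \<in> partitions"
      using decreasing_Zinf_plus_shift[OF h] T
      by (auto simp: partitions_def p_def eventually_sequentially intro!: nat_mono exI[of _ T])
  qed
  ultimately show "ket ` partitions = Zinf_plus"
    by blast
qed

lemma ket_star_image: "ket_star ` partitions = Zinf_minus"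
proof -
  have "ket_star p \<in> Zinf_minus" if p: "p \<in> partitions" for p
  proof -
    have "p t \<le> p s" if "s < t" for s t
      using p that by (auto simp: partitions_def)
    then have "ket_star p s < ket_star p t" if "s < t" for s t
      using that by (fastforce simp: ket_star_def)
    moreover have "\<forall>\<^sub>F t in sequentially. p t = 0"
      using p by (simp add: partitions_def)
    then have "\<forall>\<^sub>F t in sequentially. ket_star p t = int t + 1"
      by eventually_elim (simp add: ket_star_def)
    ultimately show ?thesis
      by (simp add: Zinf_minus_def)
  qed
  moreover have "h \<in> ket_star ` partitions" if h: "h \<in> Zinf_minus" for h
  proof
    define p where "p t = nat (int t + 1 - h t)" for t
    obtain T where T: "\<And>t. T \<le> t \<Longrightarrow> h t = int t + 1"
      using h by (auto simp: Zinf_minus_def eventually_sequentially)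
    have "h t \<le> int t + 1" for t
      using increasing_Zinf_minus_shift[OF h, of t "max T t"] T[of "max T t"] by simp
    then show "h = ket_star p"
      by (auto simp: ket_star_def p_def)
    have "p t \<le> p s" if "s \<le> t" for s t
      using increasing_Zinf_minus_shift[OF h that] by (simp add: p_def)
    then show "p \<in> partitions"
      using T by (auto simp: partitions_def p_def eventually_sequentially intro!: exI[of _ T])
  qed
  ultimately show ?thesis
    by blast
qed

lemma nat_index_ket: "p \<in> partitions \<Longrightarrow> nat_index (ket p) = ket_star (conjugate p)"
  using ket_bij by (simp add: nat_index_def the_inv_into_f_f bij_betw_def)

lemma nat_index_Zinf:
  assumes "h \<in> Zinf 0"
  shows "nat_index h \<in> Zinf 1"
proof -
  obtain p where "p \<in> partitions" "h = ket p"
    using assms ket_bij by (auto simp: Zinf_def bij_betw_def)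
  then show ?thesis
    using ket_star_image conjugate_partitions by (auto simp: Zinf_def nat_index_ket)
qed

text \<open>This is the numerical form of complementarity: for the vacuum the two counts differ by
  a, and adding cells to the diagram changes both counts equally. The proof locates one boundary
  cell of the diagram from its row and from its column.\<close>

lemma depth_nat_index:
  assumes "h \<in> Zinf 0"
  shows "int (depth 1 (nat_index h) a) = int (depth 0 h a) + a"
proof -
  obtain p where p: "p \<in> partitions" and h: "h = ket p"
    using assms ket_bij by (auto simp: Zinf_def bij_betw_def)
  let ?d = "depth 0 h a"
  have d: "t < ?d \<longleftrightarrow> a + int t < int (p t)" for t
    using less_depth_iff[OF assms] by (auto simp: h ket_def)
  \<comment> \<open>If the sum were negative, the criterion \<open>d\<close> at t = ?d would give ?d
    < ?d, since parts are nonnegative.\<close>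
  have nonneg: "0 \<le> int ?d + a"
    using d[of ?d] by auto
  have "depth 1 (nat_index h) a = nat (int ?d + a)"
  proof (rule nat_eqI_less)
    fix t
    have "t < depth 1 (nat_index h) a \<longleftrightarrow> int t + 1 - int (conjugate p t) \<le> a"
      using less_depth_iff[OF nat_index_Zinf[OF assms]]
      by (simp add: h nat_index_ket p ket_star_def)
    also have "\<dots> \<longleftrightarrow> int t < int ?d + a"
    proof (cases "a \<le> int t")
      case True
      \<comment> \<open>With s = t - a, column t meets row s exactly when a + s < p s, which is the
        criterion for s < ?d. In the other case, t < a, both sides hold trivially.\<close>
      then have "int t + 1 - int (conjugate p t) \<le> a \<longleftrightarrow> nat (int t - a) < conjugate p t"
        by linarith
      also have "\<dots> \<longleftrightarrow> t < p (nat (int t - a))"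
        by (rule less_conjugate_iff[OF p])
      also have "\<dots> \<longleftrightarrow> nat (int t - a) < ?d"
        using True d[of "nat (int t - a)"] by simp
      finally show ?thesis
        using True by linarith
    qed auto
    finally show "t < depth 1 (nat_index h) a \<longleftrightarrow> t < nat (int ?d + a)"
      by (simp only: zless_nat_eq_int_zless)
  qed
  with nonneg show ?thesis
    by simp
qed

lemma bij_nat_index: "bij_betw nat_index (Zinf 0) (Zinf 1)"
proof (rule bij_betw_imageI)
  show "inj_on nat_index (Zinf 0)"
  proof (rule inj_onI)
    fix h k assume "h \<in> Zinf 0" "k \<in> Zinf 0" "nat_index h = nat_index k"
    then show "h = k"
      using depth_nat_index[of h] depth_nat_index[of k] by (intro depth_inj) auto
  qed
  show "nat_index ` Zinf 0 = Zinf 1"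
  proof
    show "Zinf 1 \<subseteq> nat_index ` Zinf 0"
    proof
      fix k assume "k \<in> Zinf 1"
      then obtain p where p: "p \<in> partitions" "k = ket_star p"
        using ket_star_image by (auto simp: Zinf_def)
      have "nat_index (ket (conjugate p)) = k"
        using p by (simp add: nat_index_ket conjugate_partitions conjugate_conjugate)
      moreover have "ket (conjugate p) \<in> Zinf 0"
        using p ket_bij conjugate_partitions by (auto simp: Zinf_def bij_betw_def)
      ultimately show "k \<in> nat_index ` Zinf 0"
        by blast
    qed
  qed (use nat_index_Zinf in blast)
qed

text \<open>By \<open>depth_nat_index\<close> the jumps of the two depths at a differ by one. The
  jump of the first is -1 or 0, that of the second 0 or 1, so exactly one of the wedges has a
  jump.\<close>

lemma range_nat_index:
  assumes "h \<in> Zinf 0"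
  shows "a \<in> range (nat_index h) \<longleftrightarrow> a \<notin> range h"
  using depth_step[OF assms, of a] depth_step[OF nat_index_Zinf[OF assms], of a]
    depth_nat_index[OF assms, of a] depth_nat_index[OF assms, of "a - 1"]
  by (auto split: if_splits)

text \<open>Source and target are interchanged between the two kinds, and so are presence and
  absence under complementation; hence both actions vanish together. Otherwise the results are
  identified by their depth functions.\<close>

lemma wedge_mod_GF_nat_index:
  assumes "h \<in> Zinf 0"
  shows "wedge_mod 1 (GF a) (nat_index h) = linext (\<lambda>k. basis (nat_index k)) (wedge_mod 0 (GF a) h)"
proof (cases "F_source 0 a \<in> range h \<and> F_target 0 a \<notin> range h")
  case True
  let ?h = "\<lambda>t. if h t = F_source 0 a then F_target 0 a else h t"
  let ?k = "\<lambda>t. if nat_index h t = F_source 1 a then F_target 1 a else nat_index h t"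
  have True': "F_source 1 a \<in> range (nat_index h)" "F_target 1 a \<notin> range (nat_index h)"
    using True range_nat_index[OF assms] by (simp_all add: F_source_def F_target_def)
  note h = replaced_wedge[OF assms conjunct1[OF True] conjunct2[OF True]]
  note k = replaced_wedge[OF nat_index_Zinf[OF assms] True']
  have "depth 1 (nat_index ?h) x = depth 1 ?k x" for x
    using depth_nat_index[OF h(1), of x] depth_nat_index[OF assms, of x] h(2)[of x] k(2)[of x]
    by (simp split: if_splits)
  then have "nat_index ?h = ?k"
    by (rule depth_inj[OF nat_index_Zinf[OF h(1)] k(1)])
  then show ?thesis
    using True True' by (simp add: wedge_mod_GF replace_val_def del: One_nat_def)
next
  case False
  then have "\<not> (F_source 1 a \<in> range (nat_index h) \<and> F_target 1 a \<notin> range (nat_index h))"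
    using range_nat_index[OF assms] by (auto simp: F_source_def F_target_def)
  with False show ?thesis
    unfolding wedge_mod_GF replace_val_def by (simp only: if_False linext_def keys_zero sum.empty)
qed


section \<open>The Bruhat order\<close>

lemma sharp_Suc:
  assumes "i < length b"
  shows "sharp b u a i = sharp b u a (Suc i) + (if u ! i \<le> a then (- 1) ^ (b ! i) else 0)"
proof (cases "u ! i \<le> a")
  case True
  then have "{k. i \<le> k \<and> k < length b \<and> u ! k \<le> a} =
      insert i {k. Suc i \<le> k \<and> k < length b \<and> u ! k \<le> a}"
    using assms by auto
  then show ?thesis
    using True by (simp add: sharp_def)
next
  case False
  then have "{k. i \<le> k \<and> k < length b \<and> u ! k \<le> a} =
      {k. Suc i \<le> k \<and> k < length b \<and> u ! k \<le> a}"
    using le_eq_less_or_eq by auto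
  then show ?thesis
    using False by (simp add: sharp_def)
qed

lemma sharp_beyond: "length b \<le> j \<Longrightarrow> sharp b u a j = 0"
  by (auto simp: sharp_def intro!: sum.neutral)

text \<open>The truncated subtraction is intended: for j inside the first block, the second block is
  counted from its beginning.\<close>

lemma sharp_append:
  assumes "length u = length b"
  shows "sharp (b @ c) (u @ v) a j = sharp b u a j + sharp c v a (j - length b)"
proof -
  let ?A = "{i. j \<le> i \<and> i < length b \<and> u ! i \<le> a}"
  let ?B = "{i. j - length b \<le> i \<and> i < length c \<and> v ! i \<le> a}"
  have "{i. j \<le> i \<and> i < length (b @ c) \<and> (u @ v) ! i \<le> a} = ?A \<union> (\<lambda>i. length b + i) ` ?B"
  proof (intro equalityI subsetI)
    fix i assume i: "i \<in> {i. j \<le> i \<and> i < length (b @ c) \<and> (u @ v) ! i \<le> a}"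
    show "i \<in> ?A \<union> (\<lambda>i. length b + i) ` ?B"
    proof (cases "i < length b")
      case False
      then have "i - length b \<in> ?B" "i = length b + (i - length b)"
        using i assms by (auto simp: nth_append)
      then show ?thesis by blast
    qed (use i assms in \<open>auto simp: nth_append\<close>)
  qed (use assms in \<open>auto simp: nth_append\<close>)
  moreover have "?A \<inter> (\<lambda>i. length b + i) ` ?B = {}"
    by auto
  ultimately have "sharp (b @ c) (u @ v) a j =
      (\<Sum>i\<in>?A. (- 1) ^ ((b @ c) ! i)) + (\<Sum>i\<in>(\<lambda>i. length b + i) ` ?B. (- 1) ^ ((b @ c) ! i))"
    unfolding sharp_def by (simp add: sum.union_disjoint)
  also have "(\<Sum>i\<in>?A. (- 1) ^ ((b @ c) ! i)) = sharp b u a j"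
    unfolding sharp_def by (rule sum.cong) (auto simp: nth_append)
  also have "(\<Sum>i\<in>(\<lambda>i. length b + i) ` ?B. (- 1) ^ ((b @ c) ! i)) = sharp c v a (j - length b)"
    unfolding sharp_def by (simp add: sum.reindex)
  finally show ?thesis .
qed

lemma sharp_single: "sharp [c] [x] a j = (if j = 0 \<and> x \<le> a then (- 1) ^ c else 0)"
  using sharp_Suc[of 0 "[c]" "[x]" a] by (cases j) (auto simp: sharp_beyond)

lemma abs_sharp_le: "\<bar>sharp b u a j\<bar> \<le> int (length b)"
proof -
  have "\<bar>sharp b u a j\<bar> \<le> (\<Sum>i | j \<le> i \<and> i < length b \<and> u ! i \<le> a. \<bar>(- 1) ^ (b ! i)\<bar>)"
    unfolding sharp_def by (rule sum_abs)
  also have "\<dots> = int (card {i. j \<le> i \<and> i < length b \<and> u ! i \<le> a})"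
    by (simp add: power_abs)
  also have "\<dots> \<le> int (card {..<length b})"
    by (simp only: of_nat_le_iff, rule card_mono) auto
  finally show ?thesis
    by simp
qed

text \<open>With d the depth at a, the entries up to a occupy the positions from d on in a
  decreasing wedge and the positions before d in an increasing one. Here they are counted between i
  and N, with the sign of the factor.\<close>

definition wedge_sharp :: "nat \<Rightarrow> nat \<Rightarrow> nat \<Rightarrow> nat \<Rightarrow> int" where
  "wedge_sharp \<epsilon> N i d = (if \<epsilon> = 0 then int (N - max i d) else - int (min N d - i))"

lemma sharp_wedge:
  assumes "h \<in> Zinf \<epsilon>" "\<epsilon> \<in> {0, 1}"
  shows "sharp (replicate N \<epsilon>) (map h [0..<N]) a i = wedge_sharp \<epsilon> N i (depth \<epsilon> h a)"
proof -
  have "h t \<le> a \<longleftrightarrow> (if \<epsilon> = 0 then depth \<epsilon> h a \<le> t else t < depth \<epsilon> h a)" for t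
    using less_depth_iff[OF assms(1), of t a] by (auto split: if_splits)
  then have "{t. i \<le> t \<and> t < N \<and> map h [0..<N] ! t \<le> a} =
      (if \<epsilon> = 0 then {max i (depth \<epsilon> h a)..<N} else {i..<min N (depth \<epsilon> h a)})"
    by (auto split: if_splits)
  then have "sharp (replicate N \<epsilon>) (map h [0..<N]) a i =
      (\<Sum>t\<in>(if \<epsilon> = 0 then {max i (depth \<epsilon> h a)..<N} else {i..<min N (depth \<epsilon> h a)}). (- 1) ^ \<epsilon>)"
    unfolding sharp_def length_replicate
    by (intro sum.cong) (auto split: if_splits)
  then show ?thesis
    using assms(2) by (auto simp: wedge_sharp_def)
qed

text \<open>Renormalized limit of \<open>sharp\<close> on truncations, for j in the finite part: as long as N exceeds
  the depth at a, truncation at N changes it by a constant that does not depend on the index. For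
  \<open>j \<ge> length b\<close> only the depth remains, which accounts for all positions in the wedge at once.\<close>

definition sharp_inf :: "nat list \<Rightarrow> nat \<Rightarrow> findex \<Rightarrow> int \<Rightarrow> nat \<Rightarrow> int" where
  "sharp_inf b \<epsilon> f a j = sharp b (fst f) a j - int (depth \<epsilon> (snd f) a)"

text \<open>No N exceeds all depths, since the depth grows without bound in one direction of a. But
  there both wedges look like the vacuum, so a bound is needed only where the depths differ.\<close>

lemma depth_truncation_bound:
  assumes "h \<in> Zinf \<epsilon>" "k \<in> Zinf \<epsilon>"
  shows "\<exists>N0. \<forall>a. depth \<epsilon> h a = depth \<epsilon> k a \<or> depth \<epsilon> h a \<le> N0 \<and> depth \<epsilon> k a \<le> N0"
proof -
  obtain R R' where R: "\<forall>a. R \<le> \<bar>a\<bar> \<longrightarrow> depth \<epsilon> h a = (if \<epsilon> = 0 then nat (- a) else nat a)"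
    and R': "\<forall>a. R' \<le> \<bar>a\<bar> \<longrightarrow> depth \<epsilon> k a = (if \<epsilon> = 0 then nat (- a) else nat a)"
    using assms depth_tail by blast
  let ?A = "{- max R R'..max R R'}"
  define N0 where "N0 = (\<Sum>a\<in>?A. depth \<epsilon> h a + depth \<epsilon> k a)"
  have "depth \<epsilon> h a = depth \<epsilon> k a \<or> depth \<epsilon> h a \<le> N0 \<and> depth \<epsilon> k a \<le> N0" for a
  proof (cases "a \<in> ?A")
    case True
    then have "depth \<epsilon> h a + depth \<epsilon> k a \<le> N0"
      unfolding N0_def by (intro member_le_sum) auto
    then show ?thesis
      by simp
  next
    case False
    then have "R \<le> \<bar>a\<bar>" "R' \<le> \<bar>a\<bar>"
      by auto
    then show ?thesis
      using R R' by simp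
  qed
  then show ?thesis
    by blast
qed

lemma wedge_sharp_le_iff:
  assumes "d = e \<or> d \<le> N \<and> e \<le> N"
  shows "x + wedge_sharp \<epsilon> N 0 d \<le> y + wedge_sharp \<epsilon> N 0 e \<longleftrightarrow> x - int d \<le> y - int e"
    and "x + wedge_sharp \<epsilon> N 0 d = y + wedge_sharp \<epsilon> N 0 e \<longleftrightarrow> x - int d = y - int e"
  using assms by (auto simp: wedge_sharp_def)

text \<open>A truncated count inside the wedge is a decreasing function of the depth alone, so the
  condition at the first wedge position implies those at all later ones.\<close>

lemma bruhat_fin_iff:
  assumes "f \<in> findices b \<epsilon>" "g \<in> findices b \<epsilon>" "\<epsilon> \<in> {0, 1}" "0 < N"
    and N: "\<And>a. depth \<epsilon> (snd g) a = depth \<epsilon> (snd f) a \<or>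
      depth \<epsilon> (snd g) a \<le> N \<and> depth \<epsilon> (snd f) a \<le> N"
  shows "bruhat_fin (b @ replicate N \<epsilon>) (truncate N g) (truncate N f) \<longleftrightarrow>
    (\<forall>a j. sharp_inf b \<epsilon> g a j \<le> sharp_inf b \<epsilon> f a j) \<and>
    (\<forall>a. sharp_inf b \<epsilon> g a 0 = sharp_inf b \<epsilon> f a 0)" (is "?L \<longleftrightarrow> ?R")
proof -
  have trunc: "sharp (b @ replicate N \<epsilon>) (truncate N k) a j =
      sharp b (fst k) a j + wedge_sharp \<epsilon> N (j - length b) (depth \<epsilon> (snd k) a)"
    if "k \<in> findices b \<epsilon>" for k a j
    using that assms(3) by (auto simp: truncate_def sharp_append sharp_wedge findices_def)
  have le: "sharp (b @ replicate N \<epsilon>) (truncate N g) a j \<le> sharp (b @ replicate N \<epsilon>) (truncate N f) a j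
      \<longleftrightarrow> sharp_inf b \<epsilon> g a j \<le> sharp_inf b \<epsilon> f a j" if "j \<le> length b" for a j
    using that wedge_sharp_le_iff(1)[OF N] by (simp add: trunc assms(1,2) sharp_inf_def)
  have eq: "sharp (b @ replicate N \<epsilon>) (truncate N g) a 0 = sharp (b @ replicate N \<epsilon>) (truncate N f) a 0
      \<longleftrightarrow> sharp_inf b \<epsilon> g a 0 = sharp_inf b \<epsilon> f a 0" for a
    using wedge_sharp_le_iff(2)[OF N] by (simp add: trunc assms(1,2) sharp_inf_def)
  show ?thesis
  proof
    assume L: ?L
    \<comment> \<open>Positivity of N makes \<open>length b\<close> a genuine position of the
      truncation, so that the finite order constrains it.\<close>
    have "sharp_inf b \<epsilon> g a j \<le> sharp_inf b \<epsilon> f a j" if "j \<le> length b" for a j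
      using L that \<open>0 < N\<close> unfolding le[OF that, symmetric] by (auto simp: bruhat_fin_def)
    moreover have "sharp_inf b \<epsilon> k a j = sharp_inf b \<epsilon> k a (min j (length b))" for k a j
      by (simp add: sharp_inf_def min_def sharp_beyond)
    ultimately have "sharp_inf b \<epsilon> g a j \<le> sharp_inf b \<epsilon> f a j" for a j
      by (metis min.cobounded2)
    moreover have "sharp_inf b \<epsilon> g a 0 = sharp_inf b \<epsilon> f a 0" for a
      using L unfolding eq[symmetric] by (auto simp: bruhat_fin_def)
    ultimately show ?R
      by blast
  next
    assume R: ?R
    have "sharp (b @ replicate N \<epsilon>) (truncate N g) a j \<le> sharp (b @ replicate N \<epsilon>) (truncate N f) a j"
      for a j
    proof (cases "j \<le> length b")
      case True
      then show ?thesis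
        using R le by blast
    next
      case False
      \<comment> \<open>Past the finite part only minus the depth is left, and
        \<open>wedge_sharp\<close> decreases in the depth for every starting position.\<close>
      have "sharp_inf b \<epsilon> g a j \<le> sharp_inf b \<epsilon> f a j"
        using R by blast
      then have "depth \<epsilon> (snd f) a \<le> depth \<epsilon> (snd g) a"
        using False by (simp add: sharp_inf_def sharp_beyond)
      then show ?thesis
        using False by (auto simp: trunc assms(1,2) sharp_beyond wedge_sharp_def)
    qed
    then show ?L
      using R eq by (simp add: bruhat_fin_def)
  qed
qed

lemma bruhat_iff:
  assumes "f \<in> findices b \<epsilon>" "g \<in> findices b \<epsilon>" "\<epsilon> \<in> {0, 1}"
  shows "bruhat b \<epsilon> g f \<longleftrightarrow>
    (\<forall>a j. sharp_inf b \<epsilon> g a j \<le> sharp_inf b \<epsilon> f a j) \<and>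
    (\<forall>a. sharp_inf b \<epsilon> g a 0 = sharp_inf b \<epsilon> f a 0)" (is "_ \<longleftrightarrow> ?R")
proof -
  have "snd g \<in> Zinf \<epsilon>" "snd f \<in> Zinf \<epsilon>"
    using assms(1,2) by (auto simp: findices_def)
  from depth_truncation_bound[OF this] obtain N0 where
    N0: "\<And>a. depth \<epsilon> (snd g) a = depth \<epsilon> (snd f) a \<or>
      depth \<epsilon> (snd g) a \<le> N0 \<and> depth \<epsilon> (snd f) a \<le> N0"
    by blast
  have *: "bruhat_fin (b @ replicate N \<epsilon>) (truncate N g) (truncate N f) \<longleftrightarrow> ?R" if "Suc N0 \<le> N" for N
  proof (rule bruhat_fin_iff[OF assms])
    show "depth \<epsilon> (snd g) a = depth \<epsilon> (snd f) a \<or>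
      depth \<epsilon> (snd g) a \<le> N \<and> depth \<epsilon> (snd f) a \<le> N" for a
      using N0[of a] that by auto
  qed (use that in simp)
  have "bruhat b \<epsilon> g f \<longleftrightarrow> (\<forall>\<^sub>F N :: nat in sequentially. ?R)"
    unfolding bruhat_def
    by (rule eventually_cong[OF _ *]) (rule eventually_ge_at_top)
  then show ?thesis
    by (simp only: eventually_const sequentially_bot not_False_eq_True)
qed

section \<open>Transport of the Bruhat order\<close>

lemma nat_f_findices: "f \<in> findices b 0 \<Longrightarrow> nat_f f \<in> findices b 1"
  using nat_index_Zinf by (auto simp: findices_def nat_f_def)

lemma bij_nat_f: "bij_betw nat_f (findices b 0) (findices b 1)"
proof (rule bij_betw_imageI)
  show "inj_on nat_f (findices b 0)"
    using bij_nat_index by (auto simp: inj_on_def findices_def nat_f_def bij_betw_def)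
  have "\<exists>f\<in>findices b 0. k = nat_f f" if k: "k \<in> findices b 1" for k
  proof -
    have "snd k \<in> nat_index ` Zinf 0"
      using k bij_nat_index by (auto simp: findices_def bij_betw_def)
    then obtain h where "h \<in> Zinf 0" "snd k = nat_index h"
      by blast
    then show ?thesis
      using k by (intro bexI[of _ "(fst k, h)"]) (auto simp: findices_def nat_f_def prod_eq_iff)
  qed
  then show "nat_f ` findices b 0 = findices b 1"
    using nat_f_findices by blast
qed

text \<open>The shift depends on a only, so it cancels in every comparison of two indices.\<close>

lemma sharp_inf_nat_f:
  assumes "f \<in> findices b 0"
  shows "sharp_inf b 1 (nat_f f) a j = sharp_inf b 0 f a j - a"
proof -
  have "snd f \<in> Zinf 0"
    using assms by (auto simp: findices_def)
  then show ?thesis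
    using depth_nat_index[of "snd f" a] by (simp add: sharp_inf_def nat_f_def)
qed

lemma bruhat_nat_f:
  assumes "f \<in> findices b 0" "g \<in> findices b 0"
  shows "bruhat b 1 (nat_f g) (nat_f f) \<longleftrightarrow> bruhat b 0 g f"
  using assms by (simp add: bruhat_iff nat_f_findices sharp_inf_nat_f del: One_nat_def)

section \<open>The Bruhat order as a locally finite partial order\<close>

lemma bruhat_refl: "bruhat b \<epsilon> f f"
  by (simp add: bruhat_def bruhat_fin_def)

text \<open>The function \<open>sharp_inf\<close> determines the index: its value at
  \<open>length b\<close> gives the depth, and differences at consecutive positions give the entries
  of the finite part.\<close>

lemma bruhat_antisym:
  assumes "f \<in> findices b \<epsilon>" "g \<in> findices b \<epsilon>" "\<epsilon> \<in> {0, 1}" "bruhat b \<epsilon> g f" "bruhat b \<epsilon> f g"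
  shows "f = g"
proof -
  have eq: "sharp_inf b \<epsilon> f a j = sharp_inf b \<epsilon> g a j" for a j
    using assms by (auto simp: bruhat_iff intro: antisym)
  have depth: "depth \<epsilon> (snd f) a = depth \<epsilon> (snd g) a" for a
    using eq[of a "length b"] by (simp add: sharp_inf_def sharp_beyond)
  then have "snd f = snd g"
    using assms by (intro depth_inj[of _ \<epsilon>]) (auto simp: findices_def)
  moreover have "fst f = fst g"
  proof (rule nth_equalityI)
    show "length (fst f) = length (fst g)"
      using assms by (auto simp: findices_def)
    fix i assume "i < length (fst f)"
    then have i: "i < length b"
      using assms by (auto simp: findices_def)
    have "fst f ! i \<le> a \<longleftrightarrow> fst g ! i \<le> a" for a
      using eq[of a i] eq[of a "Suc i"] depth[of a] i
      by (auto simp: sharp_inf_def sharp_Suc split: if_splits)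
    then show "fst f ! i = fst g ! i"
      by (meson antisym order_refl)
  qed
  ultimately show ?thesis
    by (simp add: prod_eq_iff)
qed

lemma bruhat_trans:
  assumes "f \<in> findices b \<epsilon>" "g \<in> findices b \<epsilon>" "k \<in> findices b \<epsilon>" "\<epsilon> \<in> {0, 1}"
    "bruhat b \<epsilon> k g" "bruhat b \<epsilon> g f"
  shows "bruhat b \<epsilon> k f"
  using assms by (simp add: bruhat_iff) (meson order_trans)

text \<open>For large |a| both endpoints have the same \<open>sharp_inf\<close>, and everything
  between them is squeezed to this value. This confines the finite part and the head of the wedge to
  a box and makes the tail that of the vacuum.\<close>

lemma finite_bruhat_interval:
  assumes "f \<in> findices b 1" "g \<in> findices b 1"
  shows "finite {k \<in> findices b 1. bruhat b 1 g k \<and> bruhat b 1 k f}"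
proof -
  obtain R1 R2 where
    R1: "\<forall>a. R1 \<le> \<bar>a\<bar> \<longrightarrow> depth 1 (snd f) a = nat a" and
    R2: "\<forall>a. R2 \<le> \<bar>a\<bar> \<longrightarrow> depth 1 (snd g) a = nat a"
    using assms depth_tail[of "snd f" 1] depth_tail[of "snd g" 1] by (auto simp: findices_def)
  obtain R3 where R3: "\<forall>x\<in>set (fst f) \<union> set (fst g). \<bar>x\<bar> \<le> R3"
  proof
    show "\<forall>x\<in>set (fst f) \<union> set (fst g). \<bar>x\<bar> \<le> (\<Sum>x\<in>set (fst f) \<union> set (fst g). \<bar>x\<bar>)"
      by (intro ballI member_le_sum) auto
  qed
  \<comment> \<open>R1 and R2 are the radii of the vacuum behaviour of the two wedges; R3 bounds the
    finite entries, and the added one keeps them strictly inside.\<close>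
  define R where "R = nat (max (max R1 R2) (R3 + 1))"
  have R: "depth 1 (snd f) a = nat a" "depth 1 (snd g) a = nat a"
      "\<And>i. i < length b \<Longrightarrow> fst f ! i \<le> a \<longleftrightarrow> 0 \<le> a"
      "\<And>i. i < length b \<Longrightarrow> fst g ! i \<le> a \<longleftrightarrow> 0 \<le> a" if a: "int R \<le> \<bar>a\<bar>" for a
  proof -
    have bounds: "R1 \<le> \<bar>a\<bar>" "R2 \<le> \<bar>a\<bar>" "R3 < \<bar>a\<bar>"
      using a by (auto simp: R_def split: if_splits)
    then show "depth 1 (snd f) a = nat a" "depth 1 (snd g) a = nat a"
      using R1 R2 by auto
    fix i assume "i < length b"
    then have "\<bar>fst f ! i\<bar> \<le> R3" "\<bar>fst g ! i\<bar> \<le> R3"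
      using R3 assms by (auto simp: findices_def)
    then show "fst f ! i \<le> a \<longleftrightarrow> 0 \<le> a" "fst g ! i \<le> a \<longleftrightarrow> 0 \<le> a"
      using bounds by auto
  qed
  have sharp_R: "sharp b (fst f) a j = sharp b (fst g) a j" if a: "int R \<le> \<bar>a\<bar>" for a j
    unfolding sharp_def using R[OF a] by (intro sum.cong) auto
  let ?U = "{u :: int list. set u \<subseteq> {- int R..int R} \<and> length u = length b}"
  let ?V = "{l :: int list. set l \<subseteq> {- int R..int R} \<and> length l = R}"
  let ?\<phi> = "\<lambda>(u :: int list, l :: int list). (u, \<lambda>t. if t < R then l ! t else int t + 1)"
  have "{k \<in> findices b 1. bruhat b 1 g k \<and> bruhat b 1 k f} \<subseteq> ?\<phi> ` (?U \<times> ?V)"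
  proof
    fix k assume "k \<in> {k \<in> findices b 1. bruhat b 1 g k \<and> bruhat b 1 k f}"
    then have k: "k \<in> findices b 1" "bruhat b 1 g k" "bruhat b 1 k f"
      by auto
    have eq: "sharp_inf b 1 k a j = sharp_inf b 1 f a j" if a: "int R \<le> \<bar>a\<bar>" for a j
    proof (rule antisym)
      have "sharp_inf b 1 f a j = sharp_inf b 1 g a j"
        using R[OF a] sharp_R[OF a] by (simp add: sharp_inf_def del: One_nat_def)
      then show "sharp_inf b 1 f a j \<le> sharp_inf b 1 k a j"
        using k assms by (simp add: bruhat_iff del: One_nat_def)
    qed (use k assms in \<open>simp add: bruhat_iff del: One_nat_def\<close>)
    have depth: "depth 1 (snd k) a = nat a" if a: "int R \<le> \<bar>a\<bar>" for a
      using eq[OF a, of "length b"] R[OF a] by (simp add: sharp_inf_def sharp_beyond)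
    have snd_k: "snd k \<in> Zinf 1"
      using k by (auto simp: findices_def)
    have le_iff: "snd k t \<le> a \<longleftrightarrow> t < nat a" if "int R \<le> \<bar>a\<bar>" for a t
      using less_depth_iff[OF snd_k, of t a] depth[OF that] by simp
    \<comment> \<open>At a = t the threshold excludes position t, at a = t + 1 it includes it; the
      entry is therefore t + 1.\<close>
    have tail: "snd k t = int t + 1" if "R \<le> t" for t
      using le_iff[of "int t" t] le_iff[of "int t + 1" t] that by (simp add: nat_add_distrib)
    have head: "snd k t \<in> {- int R..int R}" if "t < R" for t
      using le_iff[of "int R" t] le_iff[of "- int R" t] that by simp
    have fst_k: "fst k ! i \<in> {- int R..int R}" if i: "i < length b" for i
    proof -
      have "fst k ! i \<le> a \<longleftrightarrow> 0 \<le> a" if a: "int R \<le> \<bar>a\<bar>" for a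
        using eq[OF a, of i] eq[OF a, of "Suc i"] depth[OF a] R[OF a] i
        by (auto simp: sharp_inf_def sharp_Suc split: if_splits)
      from this[of "int R"] this[of "- int R - 1"] show ?thesis
        by simp
    qed
    have "fst k \<in> ?U"
      using fst_k k(1) by (auto simp: findices_def set_conv_nth)
    moreover have "map (snd k) [0..<R] \<in> ?V"
      using head by auto
    moreover have "k = ?\<phi> (fst k, map (snd k) [0..<R])"
      using tail by (auto simp: prod_eq_iff)
    ultimately show "k \<in> ?\<phi> ` (?U \<times> ?V)"
      by blast
  qed
  moreover have "finite (?\<phi> ` (?U \<times> ?V))"
    by (intro finite_imageI finite_cartesian_product finite_lists_length_eq) auto
  ultimately show ?thesis
    by (rule finite_subset)
qed


section \<open>Unitriangularity of the bar maps\<close>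

lemma keys_comult_GE:
  assumes "(w, w') \<in> Poly_Mapping.keys (comult_gen (GE a))"
  shows "w = FMon [] \<and> w' = FMon [GE a] \<or> w = FMon [GE a] \<and> w' = FMon [GK (a + 1), GKinv a]"
proof -
  have one: "(1 :: uqfree) = basis (FMon [])"
    by (simp flip: single_one zero_fmon_def)
  have "comult_gen (GE a) =
      basis (FMon [], FMon [GE a]) + basis (FMon [GE a], FMon [GK (a + 1), GKinv a])"
    unfolding comult_gen.simps one mult_single by (simp add: plus_fmon_def)
  then show ?thesis
    using assms subsetD[OF Poly_Mapping.keys_add] by (fastforce split: if_splits)
qed

text \<open>The contribution of a single tensor factor to \<open>sharp\<close>; its change under a
  generator is the weight of that generator for both kinds of factors.\<close>

definition step :: "nat \<Rightarrow> int \<Rightarrow> int \<Rightarrow> int" where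
  "step c x a = (if x \<le> a then (- 1) ^ c else 0)"

lemma keys_VW_mod_K:
  assumes "y \<in> Poly_Mapping.keys (VW_mod c g x)" "g \<in> {GK a, GKinv a}"
  shows "y = x"
  using assms by (auto simp: VW_mod_def in_keys_iff lookup_single when_def split: if_splits)

text \<open>Moving v from a + 1 to a creates an entry up to a, moving w from a to a + 1 destroys
  one; the sign attached to W makes both a gain.\<close>

lemma keys_VW_mod_E:
  assumes "y \<in> Poly_Mapping.keys (VW_mod c (GE a) x)" "c \<in> {0, 1}"
  shows "step c y t = step c x t + (if t = a then 1 else 0)"
  using assms by (auto simp: VW_mod_def step_def split: if_splits)

lemma keys_VW_mod_F:
  assumes "y \<in> Poly_Mapping.keys (VW_mod c (GF a) x)" "c \<in> {0, 1}"
  shows "step c y t = step c x t - (if t = a then 1 else 0)"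
  using assms by (auto simp: VW_mod_def step_def split: if_splits)

text \<open>What the action of an element of weight \<open>\<mu>\<close> of the positive part does to the indices.\<close>

definition raised :: "nat list \<Rightarrow> (int \<Rightarrow> int) \<Rightarrow> int list \<Rightarrow> int list \<Rightarrow> bool" where
  "raised b \<mu> g f \<longleftrightarrow> length g = length b \<and> length f = length b \<and>
     (\<forall>a j. sharp b g a j \<le> sharp b f a j + \<mu> a) \<and> (\<forall>a. sharp b g a 0 = sharp b f a 0 + \<mu> a)"

lemma raised_refl: "length f = length b \<Longrightarrow> raised b (\<lambda>_. 0) f f"
  by (simp add: raised_def)

lemma raised_trans:
  assumes "raised b \<mu> g f" "raised b \<nu> k g"
  shows "raised b (\<lambda>a. \<mu> a + \<nu> a) k f"
proof -
  have "sharp b k a j \<le> sharp b f a j + (\<mu> a + \<nu> a)" for a j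
  proof -
    have "sharp b k a j \<le> sharp b g a j + \<nu> a" "sharp b g a j \<le> sharp b f a j + \<mu> a"
      using assms by (simp_all add: raised_def)
    then show ?thesis by simp
  qed
  then show ?thesis
    using assms by (simp add: raised_def)
qed

text \<open>The nonnegativity of the total serves the positions past the new factor, where both
  counts are empty.\<close>

lemma raised_snoc:
  assumes "raised b \<mu> g f" "\<And>a. step c y a = step c x a + \<nu> a" "\<And>a. 0 \<le> \<mu> a + \<nu> a"
  shows "raised (b @ [c]) (\<lambda>a. \<mu> a + \<nu> a) (snoc g y) (snoc f x)"
proof -
  have len: "length g = length b" "length f = length b"
    using assms(1) by (simp_all add: raised_def)
  have sharp_snoc: "sharp (b @ [c]) (snoc u z) a j =
      sharp b u a j + (if j \<le> length b then step c z a else 0)" if "length u = length b" for u z a j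
    using that by (auto simp: sharp_append sharp_single step_def)
  have "sharp b g a j \<le> sharp b f a j + \<mu> a" for a j
    using assms(1) by (simp add: raised_def)
  from this have "sharp (b @ [c]) (snoc g y) a j \<le> sharp (b @ [c]) (snoc f x) a j + (\<mu> a + \<nu> a)" for a j
    using assms(2)[of a] assms(3)[of a] by (simp add: sharp_snoc len sharp_beyond)
  then show ?thesis
    using assms(1,2) by (simp add: raised_def sharp_snoc)
qed

text \<open>Each term of the iterated comultiplication applies \<open>E_a\<close> to one factor and
  scalars to the others. Counts starting at or before that factor gain one, later ones do not
  change; hence an inequality in general and an equality at position 0.\<close>

lemma keys_T_mod_GE:
  assumes "set b \<subseteq> {0, 1}"
  shows "n \<le> length b \<Longrightarrow> length f = n \<Longrightarrow> g \<in> Poly_Mapping.keys (T_mod b n (GE a) f) \<Longrightarrow>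
    raised (take n b) (\<lambda>t. if t = a then 1 else 0) g f"
proof (induction n arbitrary: f g)
  case (Suc n)
  obtain w w' g' y where w: "(w, w') \<in> Poly_Mapping.keys (comult_gen (GE a))"
    and g': "g' \<in> Poly_Mapping.keys (word_act (T_mod b n) w (basis (butlast f)))"
    and y: "y \<in> Poly_Mapping.keys (word_act (VW_mod (b ! n)) w' (basis (last f)))"
    and g: "g = snoc g' y"
    using Suc.prems(3) unfolding T_mod.simps by (rule keys_act2E)
  have "f \<noteq> []"
    using Suc.prems by auto
  then have f: "f = snoc (butlast f) (last f)" and len: "length (butlast f) = n"
    using Suc.prems by auto
  have n: "n < length b" "take (Suc n) b = take n b @ [b ! n]" "b ! n \<in> {0, 1}"
    using Suc.prems(1) nth_mem[of n b] subsetD[OF assms] by (simp_all add: take_Suc_conv_app_nth)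
  from keys_comult_GE[OF w] show ?case
  proof (elim disjE conjE)
    assume "w = FMon []" "w' = FMon [GE a]"
    then have "g' = butlast f" "y \<in> Poly_Mapping.keys (VW_mod (b ! n) (GE a) (last f))"
      using g' y by simp_all
    moreover have "raised (take n b) (\<lambda>_. 0) (butlast f) (butlast f)"
      using n len by (intro raised_refl) simp
    ultimately have "raised (take n b @ [b ! n]) (\<lambda>t. 0 + (if t = a then 1 else 0))
        (snoc g' y) (snoc (butlast f) (last f))"
      using keys_VW_mod_E n(3) by (intro raised_snoc) auto
    then show ?thesis
      by (simp add: g n flip: f)
  next
    assume w: "w = FMon [GE a]" "w' = FMon [GK (a + 1), GKinv a]"
    have "raised (take n b) (\<lambda>t. if t = a then 1 else 0) g' (butlast f)"
      using g' n len by (intro Suc.IH) (simp_all add: w)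
    moreover have "y = last f"
      using y unfolding w by (auto elim!: keys_linextE dest!: keys_VW_mod_K)
    ultimately have "raised (take n b @ [b ! n]) (\<lambda>t. (if t = a then 1 else 0) + 0)
        (snoc g' y) (snoc (butlast f) (last f))"
      by (intro raised_snoc) auto
    then show ?thesis
      by (simp add: g n flip: f)
  qed
qed simp

section \<open>Weights of words\<close>

lemma wt_Nil [simp]: "wt (FMon []) = 0"
  and wt_Cons: "wt (FMon (g # w)) = wt_gen g + wt (FMon w)"
  by (simp_all add: wt_def)

lemma lookup_wt_GE:
  "Poly_Mapping.lookup (wt (FMon (GE a # w))) =
     (\<lambda>t. Poly_Mapping.lookup (wt (FMon w)) t + (if t = a then 1 else 0))"
  by (auto simp: fun_eq_iff wt_Cons lookup_add lookup_single when_def)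

lemma lookup_wt_GF:
  "Poly_Mapping.lookup (wt (FMon (GF a # w))) =
     (\<lambda>t. Poly_Mapping.lookup (wt (FMon w)) t - (if t = a then 1 else 0))"
  by (auto simp: fun_eq_iff wt_Cons lookup_add lookup_minus lookup_single when_def)

lemma keys_T_mod_pos_word:
  assumes "set b \<subseteq> {0, 1}" "n \<le> length b" "\<And>f. f \<in> Poly_Mapping.keys x \<Longrightarrow> length f = n"
  shows "set ls \<subseteq> range GE \<Longrightarrow> g \<in> Poly_Mapping.keys (word_act (T_mod b n) (FMon ls) x) \<Longrightarrow>
    \<exists>f\<in>Poly_Mapping.keys x. raised (take n b) (Poly_Mapping.lookup (wt (FMon ls))) g f"
proof (induction ls arbitrary: g)
  case Nil
  then have "raised (take n b) (\<lambda>_. 0) g g"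
    using assms by (intro raised_refl) simp
  with Nil show ?case
    by (auto simp: zero_poly_mapping.rep_eq)
next
  case (Cons l ls)
  then obtain a where a: "l = GE a"
    by auto
  obtain g' where g': "g' \<in> Poly_Mapping.keys (word_act (T_mod b n) (FMon ls) x)"
    and g: "g \<in> Poly_Mapping.keys (T_mod b n (GE a) g')"
    using Cons.prems(2) unfolding a word_act_Cons by (rule keys_linextE)
  obtain f where f: "f \<in> Poly_Mapping.keys x"
    and r: "raised (take n b) (Poly_Mapping.lookup (wt (FMon ls))) g' f"
    using Cons.IH[OF _ g'] Cons.prems(1) by auto
  have "raised (take n b) (\<lambda>t. if t = a then 1 else 0) g g'"
    using keys_T_mod_GE[OF assms(1,2) _ g] r assms(2) by (simp add: raised_def)
  from raised_trans[OF r this] f show ?case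
    unfolding a lookup_wt_GE by blast
qed

lemma keys_VW_mod_neg_word:
  assumes "c \<in> {0, 1}"
  shows "set ls \<subseteq> range GF \<Longrightarrow> y \<in> Poly_Mapping.keys (word_act (VW_mod c) (FMon ls) (basis x)) \<Longrightarrow>
    step c y a = step c x a + Poly_Mapping.lookup (wt (FMon ls)) a"
proof (induction ls arbitrary: y)
  case (Cons l ls)
  then obtain d where d: "l = GF d"
    by auto
  obtain y' where y': "y' \<in> Poly_Mapping.keys (word_act (VW_mod c) (FMon ls) (basis x))"
    and y: "y \<in> Poly_Mapping.keys (VW_mod c (GF d) y')"
    using Cons.prems(2) unfolding d word_act_Cons by (rule keys_linextE)
  show ?case
    using Cons.IH[OF _ y'] Cons.prems(1) keys_VW_mod_F[OF y assms, of a]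
    by (auto simp: d lookup_wt_GF)
qed simp

lemma keys_wedge_mod_GF:
  assumes "h \<in> Zinf \<epsilon>" "k \<in> Poly_Mapping.keys (wedge_mod \<epsilon> (GF a) h)"
  shows "k \<in> Zinf \<epsilon>" and "depth \<epsilon> k t = depth \<epsilon> h t + (if t = a then 1 else 0)"
proof -
  from assms(2) have *: "F_source \<epsilon> a \<in> range h" "F_target \<epsilon> a \<notin> range h"
    and k: "k = (\<lambda>t. if h t = F_source \<epsilon> a then F_target \<epsilon> a else h t)"
    unfolding wedge_mod_GF replace_val_def by (simp_all split: if_splits)
  show "k \<in> Zinf \<epsilon>" and "depth \<epsilon> k t = depth \<epsilon> h t + (if t = a then 1 else 0)"
    unfolding k using replaced_wedge[OF assms(1) *] by blast+
qed

lemma keys_wedge_mod_neg_word: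
  assumes "h \<in> Zinf \<epsilon>"
  shows "set ls \<subseteq> range GF \<Longrightarrow> k \<in> Poly_Mapping.keys (word_act (wedge_mod \<epsilon>) (FMon ls) (basis h)) \<Longrightarrow>
    k \<in> Zinf \<epsilon> \<and> int (depth \<epsilon> k a) = int (depth \<epsilon> h a) - Poly_Mapping.lookup (wt (FMon ls)) a"
proof (induction ls arbitrary: k)
  case (Cons l ls)
  then obtain d where d: "l = GF d"
    by auto
  obtain k' where k': "k' \<in> Poly_Mapping.keys (word_act (wedge_mod \<epsilon>) (FMon ls) (basis h))"
    and k: "k \<in> Poly_Mapping.keys (wedge_mod \<epsilon> (GF d) k')"
    using Cons.prems(2) unfolding d word_act_Cons by (rule keys_linextE)
  have IH: "k' \<in> Zinf \<epsilon>"
      "int (depth \<epsilon> k' a) = int (depth \<epsilon> h a) - Poly_Mapping.lookup (wt (FMon ls)) a"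
    using Cons.IH[OF _ k'] Cons.prems(1) by auto
  show ?case
    using keys_wedge_mod_GF[OF IH(1) k] IH(2)
    by (auto simp: d lookup_wt_GF)
qed (use assms in simp)

lemma quasi_R_matrix_keys:
  assumes "quasi_R_matrix k \<Theta>" "(w, w') \<in> Poly_Mapping.keys (\<Theta> \<mu>)"
  obtains ls ls' where "w = FMon ls" "w' = FMon ls'" "set ls \<subseteq> GE ` sub_roots k"
    "set ls' \<subseteq> GF ` sub_roots k" "wt (FMon ls) = \<mu>" "wt (FMon ls') = - \<mu>"
proof -
  have "(w, w') \<in> pos_words k \<mu> \<times> neg_words k (- \<mu>)"
    using assms unfolding quasi_R_matrix_def by blast
  then show ?thesis
    by (intro that[of "letters w" "letters w'"]) (auto simp: pos_words_def neg_words_def)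
qed

section \<open>Finiteness of the quasi-R-matrix sums\<close>

lemma keys_pos_weight_subset:
  "set ls \<subseteq> GE ` S \<Longrightarrow> Poly_Mapping.keys (wt (FMon ls)) \<subseteq> S"
proof (induction ls)
  case (Cons l ls)
  then obtain a where "l = GE a" "a \<in> S"
    by auto
  with Cons show ?case
    using Poly_Mapping.keys_add[of "wt_gen l" "wt (FMon ls)"] by (auto simp: wt_Cons)
qed simp

lemma pos_weight_nonneg:
  "set ls \<subseteq> range GE \<Longrightarrow> 0 \<le> Poly_Mapping.lookup (wt (FMon ls)) a"
  by (induction ls) (auto simp: lookup_wt_GE)

lemma finite_bounded_poly_mappings:
  fixes S :: "'a set" and M :: int
  assumes "finite S"
  shows "finite {\<mu> :: 'a \<Rightarrow>\<^sub>0 int. Poly_Mapping.keys \<mu> \<subseteq> S \<and> (\<forall>a. Poly_Mapping.lookup \<mu> a \<in> {- M..M})}"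
    (is "finite ?A")
proof (rule inj_on_finite)
  show "inj_on Poly_Mapping.lookup ?A"
    by (rule inj_onI) (simp only: poly_mapping_eq_iff)
  show "Poly_Mapping.lookup ` ?A \<subseteq>
      {\<phi>. \<forall>a. (a \<in> S \<longrightarrow> \<phi> a \<in> {- M..M}) \<and> (a \<notin> S \<longrightarrow> \<phi> a = 0)}"
  proof (rule image_subsetI, rule CollectI, intro allI conjI impI)
    fix \<mu> a assume \<mu>: "\<mu> \<in> ?A"
    show "Poly_Mapping.lookup \<mu> a \<in> {- M..M}"
      using \<mu> by blast
    assume "a \<notin> S"
    then have "a \<notin> Poly_Mapping.keys \<mu>"
      using \<mu> by blast
    then show "Poly_Mapping.lookup \<mu> a = 0"
      by (simp only: in_keys_iff not_not)
  qed
  show "finite {\<phi>. \<forall>a. (a \<in> S \<longrightarrow> \<phi> a \<in> {- M..M}) \<and> (a \<notin> S \<longrightarrow> \<phi> a = (0 :: int))}"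
    using assms by (intro finite_set_of_finite_funs) auto
qed

text \<open>The finite part alone bounds \<mu>: its value at a is a difference of two counts over n
  factors, whence the bound \<open>2 * int n\<close>, and it is supported on the finitely many roots
  of the k-th subalgebra. The second module may therefore be arbitrary.\<close>

lemma finite_quasi_R_support:
  assumes "quasi_R_matrix k \<Theta>" "set b \<subseteq> {0, 1}" "n \<le> length b"
    and "\<And>f. f \<in> Poly_Mapping.keys x \<Longrightarrow> length f = n"
  shows "finite {\<mu>. act2 p (T_mod b n) \<sigma> (\<Theta> \<mu>) x y \<noteq> 0}"
proof (rule finite_subset)
  show "{\<mu>. act2 p (T_mod b n) \<sigma> (\<Theta> \<mu>) x y \<noteq> 0} \<subseteq>
      {\<mu>. Poly_Mapping.keys \<mu> \<subseteq> sub_roots k \<and> (\<forall>a. Poly_Mapping.lookup \<mu> a \<in> {- (2 * int n)..2 * int n})}"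
  proof
    fix \<mu> assume "\<mu> \<in> {\<mu>. act2 p (T_mod b n) \<sigma> (\<Theta> \<mu>) x y \<noteq> 0}"
    then obtain l where "l \<in> Poly_Mapping.keys (act2 p (T_mod b n) \<sigma> (\<Theta> \<mu>) x y)"
      by (metis (mono_tags, lifting) ex_in_conv keys_eq_empty mem_Collect_eq)
    then obtain w w' g where w: "(w, w') \<in> Poly_Mapping.keys (\<Theta> \<mu>)"
      and g: "g \<in> Poly_Mapping.keys (word_act (T_mod b n) w x)"
      by (rule keys_act2E)
    obtain ls where ls: "w = FMon ls" "set ls \<subseteq> GE ` sub_roots k" "wt (FMon ls) = \<mu>"
      using quasi_R_matrix_keys[OF assms(1) w] by metis
    obtain f where "raised (take n b) (Poly_Mapping.lookup \<mu>) g f"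
      using keys_T_mod_pos_word[where ls = ls and g = g, OF assms(2-4)] g ls by blast
    then have "Poly_Mapping.lookup \<mu> a = sharp (take n b) g a 0 - sharp (take n b) f a 0" for a
      by (simp add: raised_def)
    moreover have "\<bar>sharp (take n b) u a 0\<bar> \<le> int n" for u a
      using abs_sharp_le[of "take n b" u a 0] assms(3) by simp
    ultimately have "Poly_Mapping.lookup \<mu> a \<in> {- (2 * int n)..2 * int n}" for a
      by (smt (verit) atLeastAtMost_iff)
    then show "\<mu> \<in> {\<mu>. Poly_Mapping.keys \<mu> \<subseteq> sub_roots k \<and>
        (\<forall>a. Poly_Mapping.lookup \<mu> a \<in> {- (2 * int n)..2 * int n})}"
      using keys_pos_weight_subset[OF ls(2)] ls(3) by simp
  qed
qed (rule finite_bounded_poly_mappings, simp add: sub_roots_def)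

lemma lookup_Sum_any_eq:
  assumes "finite {i. \<phi> i \<noteq> 0}" "\<And>i. i \<noteq> i0 \<Longrightarrow> Poly_Mapping.lookup (\<phi> i) j = 0"
  shows "Poly_Mapping.lookup (Sum_any \<phi>) j = Poly_Mapping.lookup (\<phi> i0) j"
proof -
  have "Sum_any \<phi> = sum \<phi> (insert i0 {i. \<phi> i \<noteq> 0})"
    using assms(1) by (intro Sum_any.expand_superset) auto
  then have "Poly_Mapping.lookup (Sum_any \<phi>) j =
      (\<Sum>i\<in>insert i0 {i. \<phi> i \<noteq> 0}. Poly_Mapping.lookup (\<phi> i) j)"
    by (simp only: lookup_sum)
  also have "\<dots> = (\<Sum>i\<in>{i0}. Poly_Mapping.lookup (\<phi> i) j)"
    using assms by (intro sum.mono_neutral_right) auto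
  finally show ?thesis
    by simp
qed

text \<open>The component of weight \<mu> raises the first n factors by \<mu> and lowers the last
  one by the same amount, so the total weight is preserved and all other counts can only
  decrease.\<close>

lemma psi_fin_unitriangular:
  assumes "quasi_R_matrix k \<Theta>" "set b \<subseteq> {0, 1}"
  shows "n \<le> length b \<Longrightarrow> length f = n \<Longrightarrow>
    (\<forall>g\<in>Poly_Mapping.keys (psi_fin \<Theta> b n f). raised (take n b) (\<lambda>_. 0) g f) \<and>
    Poly_Mapping.lookup (psi_fin \<Theta> b n f) f = 1"
proof (induction n arbitrary: f)
  case 0
  then show ?case
    by (simp add: raised_refl)
next
  case (Suc n)
  show ?case
  proof (cases "n = 0")
    case True
    then show ?thesis
      using Suc.prems by (simp add: raised_refl)
  next
    case False
    let ?x = "psi_fin \<Theta> b n (butlast f)"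
    let ?act = "\<lambda>\<mu>. act2 snoc (T_mod b n) (VW_mod (b ! n)) (\<Theta> \<mu>) ?x (basis (last f))"
    have psi: "psi_fin \<Theta> b (Suc n) f = Sum_any ?act"
      using False by (simp add: Theta_act_def)
    have "f \<noteq> []"
      using Suc.prems by auto
    then have f: "f = snoc (butlast f) (last f)" and len: "length (butlast f) = n"
      using Suc.prems by auto
    have n: "n \<le> length b" "take (Suc n) b = take n b @ [b ! n]" "b ! n \<in> {0, 1}"
      using Suc.prems(1) nth_mem[of n b] subsetD[OF assms(2)]
      by (simp_all add: take_Suc_conv_app_nth)
    have IH: "raised (take n b) (\<lambda>_. 0) g (butlast f)" if "g \<in> Poly_Mapping.keys ?x" for g
      using Suc.IH[OF n(1) len] that by blast
    have len_x: "length g = n" if "g \<in> Poly_Mapping.keys ?x" for g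
      using IH[OF that] n(1) by (simp add: raised_def)
    have act: "\<exists>g' y. g = snoc g' y \<and> (\<forall>a. 0 \<le> Poly_Mapping.lookup \<mu> a) \<and>
        raised (take n b) (Poly_Mapping.lookup \<mu>) g' (butlast f) \<and>
        (\<forall>a. step (b ! n) y a = step (b ! n) (last f) a - Poly_Mapping.lookup \<mu> a)"
      if g: "g \<in> Poly_Mapping.keys (?act \<mu>)" for g \<mu>
    proof -
      obtain w w' g' y where w: "(w, w') \<in> Poly_Mapping.keys (\<Theta> \<mu>)"
        and g': "g' \<in> Poly_Mapping.keys (word_act (T_mod b n) w ?x)"
        and y: "y \<in> Poly_Mapping.keys (word_act (VW_mod (b ! n)) w' (basis (last f)))"
        and g_eq: "g = snoc g' y"
        using g by (rule keys_act2E)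
      obtain ls ls' where ls: "w = FMon ls" "w' = FMon ls'" "set ls \<subseteq> GE ` sub_roots k"
          "set ls' \<subseteq> GF ` sub_roots k" "wt (FMon ls) = \<mu>" "wt (FMon ls') = - \<mu>"
        using quasi_R_matrix_keys[OF assms(1) w] .
      have ran: "set ls \<subseteq> range GE" "set ls' \<subseteq> range GF"
        using ls(3,4) by auto
      obtain f' where f': "f' \<in> Poly_Mapping.keys ?x"
        "raised (take n b) (Poly_Mapping.lookup \<mu>) g' f'"
        using keys_T_mod_pos_word[OF assms(2) n(1) len_x ran(1)] g' ls by blast
      have "raised (take n b) (Poly_Mapping.lookup \<mu>) g' (butlast f)"
        using raised_trans[OF IH[OF f'(1)] f'(2)] by simp
      moreover have "step (b ! n) y a = step (b ! n) (last f) a - Poly_Mapping.lookup \<mu> a" for a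
        using keys_VW_mod_neg_word[OF n(3) ran(2), of y "last f" a] y ls by simp
      moreover have "0 \<le> Poly_Mapping.lookup \<mu> a" for a
        using pos_weight_nonneg[OF ran(1)] ls by metis
      ultimately show ?thesis
        using g_eq by blast
    qed
    have "raised (take (Suc n) b) (\<lambda>_. 0) g f"
      if g_keys: "g \<in> Poly_Mapping.keys (Sum_any ?act)" for g
    proof -
      obtain \<mu> where "g \<in> Poly_Mapping.keys (?act \<mu>)"
        using g_keys by (rule keys_Sum_anyE)
      then obtain g' y where g: "g = snoc g' y"
        and *: "raised (take n b) (Poly_Mapping.lookup \<mu>) g' (butlast f)"
          "\<And>a. step (b ! n) y a = step (b ! n) (last f) a + - Poly_Mapping.lookup \<mu> a"
        using act[of g \<mu>] by auto
      have "raised (take n b @ [b ! n]) (\<lambda>a. Poly_Mapping.lookup \<mu> a + - Poly_Mapping.lookup \<mu> a)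
          (snoc g' y) (snoc (butlast f) (last f))"
        by (rule raised_snoc[OF *]) simp
      then show ?thesis
        by (simp add: g n flip: f)
    qed
    moreover have "Poly_Mapping.lookup (Sum_any ?act) f = 1"
    proof -
      \<comment> \<open>To return to f the last entry must be unchanged, but its contribution drops
        by exactly \<mu>. So the diagonal sees only the component at 0, which is 1 \<otimes>
        1.\<close>
      have "Poly_Mapping.lookup (?act \<mu>) f = 0" if "\<mu> \<noteq> 0" for \<mu>
      proof (rule ccontr)
        assume "Poly_Mapping.lookup (?act \<mu>) f \<noteq> 0"
        then have "f \<in> Poly_Mapping.keys (?act \<mu>)"
          by (simp add: in_keys_iff)
        from act[OF this] obtain g' y where "f = snoc g' y"
          "\<And>a. step (b ! n) y a = step (b ! n) (last f) a - Poly_Mapping.lookup \<mu> a"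
          by blast
        then have "Poly_Mapping.lookup \<mu> a = 0" for a
          by simp
        then have "\<mu> = 0"
          by (intro poly_mapping_eqI) simp
        with that show False by simp
      qed
      moreover have "finite {\<mu>. ?act \<mu> \<noteq> 0}"
        by (rule finite_quasi_R_support[OF assms n(1) len_x])
      ultimately have "Poly_Mapping.lookup (Sum_any ?act) f = Poly_Mapping.lookup (?act 0) f"
        by (intro lookup_Sum_any_eq)
      also have "?act 0 = tensor snoc ?x (basis (last f))"
        using assms(1) by (simp add: quasi_R_matrix_def tens2_one act2_basis)
      also have "Poly_Mapping.lookup \<dots> f = Poly_Mapping.lookup ?x (butlast f)"
        using lookup_tensor_basis[of snoc "last f" ?x "butlast f"] by (simp add: inj_def flip: f)
      also have "\<dots> = 1"
        using Suc.IH[OF n(1) len] by blast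
      finally show ?thesis .
    qed
    ultimately show ?thesis
      unfolding psi by blast
  qed
qed

lemma psi_fin_keys:
  assumes "quasi_R_matrix k \<Theta>" "set b \<subseteq> {0, 1}" "length u = length b"
    "g \<in> Poly_Mapping.keys (psi_fin \<Theta> b (length b) u)"
  shows "raised b (\<lambda>_. 0) g u" and "length g = length b"
  using psi_fin_unitriangular[OF assms(1,2), of "length b" u] assms(3,4)
  by (auto simp: raised_def)

text \<open>The same cancellation as for finite tensor products, with the depth of the wedge in the
  role of the last factor: \<open>sharp_inf\<close> subtracts the depth, which grows by exactly
  \<mu>.\<close>

lemma psi_unitriangular:
  assumes "quasi_R_matrix k \<Theta>" "set b \<subseteq> {0, 1}" "\<epsilon> \<in> {0, 1}" "f \<in> findices b \<epsilon>"
  shows "g \<in> Poly_Mapping.keys (psi \<Theta> b \<epsilon> f) \<Longrightarrow> g \<in> findices b \<epsilon> \<and> bruhat b \<epsilon> g f"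
    and "Poly_Mapping.lookup (psi \<Theta> b \<epsilon> f) f = 1"
proof -
  let ?n = "length b"
  let ?x = "psi_fin \<Theta> b ?n (fst f)"
  let ?act = "\<lambda>\<mu>. act2 Pair (T_mod b ?n) (wedge_mod \<epsilon>) (\<Theta> \<mu>) ?x (basis (snd f))"
  have len: "length (fst f) = ?n" and snd_f: "snd f \<in> Zinf \<epsilon>"
    using assms(4) by (auto simp: findices_def)
  note x = psi_fin_keys[OF assms(1,2) len]
  have act: "snd g \<in> Zinf \<epsilon> \<and> raised b (Poly_Mapping.lookup \<mu>) (fst g) (fst f) \<and>
      (\<forall>a. int (depth \<epsilon> (snd g) a) = int (depth \<epsilon> (snd f) a) + Poly_Mapping.lookup \<mu> a)"
    if g: "g \<in> Poly_Mapping.keys (?act \<mu>)" for g \<mu>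
  proof -
    obtain w w' u h where w: "(w, w') \<in> Poly_Mapping.keys (\<Theta> \<mu>)"
      and u: "u \<in> Poly_Mapping.keys (word_act (T_mod b ?n) w ?x)"
      and h: "h \<in> Poly_Mapping.keys (word_act (wedge_mod \<epsilon>) w' (basis (snd f)))"
      and g_eq: "g = (u, h)"
      using g by (rule keys_act2E)
    obtain ls ls' where ls: "w = FMon ls" "w' = FMon ls'" "set ls \<subseteq> GE ` sub_roots k"
        "set ls' \<subseteq> GF ` sub_roots k" "wt (FMon ls) = \<mu>" "wt (FMon ls') = - \<mu>"
      using quasi_R_matrix_keys[OF assms(1) w] .
    have ran: "set ls \<subseteq> range GE" "set ls' \<subseteq> range GF"
      using ls(3,4) by auto
    have "\<exists>u'\<in>Poly_Mapping.keys ?x. raised (take ?n b) (Poly_Mapping.lookup (wt (FMon ls))) u u'"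
      by (rule keys_T_mod_pos_word[OF assms(2) order_refl _ ran(1)]) (use u ls(1) x(2) in simp_all)
    then obtain u' where u': "u' \<in> Poly_Mapping.keys ?x" "raised b (Poly_Mapping.lookup \<mu>) u u'"
      using ls(5) by auto
    have "raised b (Poly_Mapping.lookup \<mu>) u (fst f)"
      using raised_trans[OF x(1)[OF u'(1)] u'(2)] by simp
    moreover have "h \<in> Zinf \<epsilon> \<and> int (depth \<epsilon> h a) = int (depth \<epsilon> (snd f) a) + Poly_Mapping.lookup \<mu> a"
      for a
      using keys_wedge_mod_neg_word[OF snd_f ran(2), of h a] h ls by simp
    ultimately show ?thesis
      by (simp add: g_eq)
  qed
  have psi: "psi \<Theta> b \<epsilon> f = Sum_any ?act" if "b \<noteq> []"
    using that by (simp add: psi_def Theta_act_def)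
  show "g \<in> findices b \<epsilon> \<and> bruhat b \<epsilon> g f" if g: "g \<in> Poly_Mapping.keys (psi \<Theta> b \<epsilon> f)"
  proof (cases "b = []")
    case True
    then show ?thesis
      using g assms(4) by (simp add: psi_def bruhat_refl)
  next
    case False
    obtain \<mu> where "g \<in> Poly_Mapping.keys (?act \<mu>)"
      using g unfolding psi[OF False] by (rule keys_Sum_anyE)
    note * = act[OF this]
    have "g \<in> findices b \<epsilon>"
      using * by (cases g) (auto simp: findices_def raised_def)
    moreover from this have "bruhat b \<epsilon> g f"
      using * assms(3,4) by (simp add: bruhat_iff sharp_inf_def raised_def algebra_simps)
    ultimately show ?thesis ..
  qed
  show "Poly_Mapping.lookup (psi \<Theta> b \<epsilon> f) f = 1"
  proof (cases "b = []")
    case True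
    then show ?thesis
      by (simp add: psi_def)
  next
    case False
    have "Poly_Mapping.lookup (?act \<mu>) f = 0" if "\<mu> \<noteq> 0" for \<mu>
    proof (rule ccontr)
      assume "Poly_Mapping.lookup (?act \<mu>) f \<noteq> 0"
      then have "f \<in> Poly_Mapping.keys (?act \<mu>)"
        by (simp add: in_keys_iff)
      from act[OF this] have "Poly_Mapping.lookup \<mu> a = 0" for a
        by simp
      then have "\<mu> = 0"
        by (intro poly_mapping_eqI) simp
      with that show False by simp
    qed
    moreover have "finite {\<mu>. ?act \<mu> \<noteq> 0}"
      by (rule finite_quasi_R_support[OF assms(1,2) order_refl x(2)])
    ultimately have "Poly_Mapping.lookup (Sum_any ?act) f = Poly_Mapping.lookup (?act 0) f"
      by (intro lookup_Sum_any_eq)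
    also have "?act 0 = tensor Pair ?x (basis (snd f))"
      using assms(1) by (simp add: quasi_R_matrix_def tens2_one act2_basis)
    also have "Poly_Mapping.lookup \<dots> f = Poly_Mapping.lookup ?x (fst f)"
      using lookup_tensor_basis[of Pair "snd f" ?x "fst f"] by (simp add: inj_def)
    also have "\<dots> = 1"
      using psi_fin_unitriangular[OF assms(1,2) order_refl len] by blast
    finally show ?thesis
      by (simp add: psi[OF False])
  qed
qed


section \<open>The isomorphism on formal sums\<close>

lemma nat_b_eq: "nat_b = linext (\<lambda>f. basis (nat_f f))"
  by (rule ext) (auto simp: nat_b_def nat_wedge_def nat_f_def intro!: linext_cong)

lemma nat_b_tensor: "nat_b (tensor Pair x y) = tensor Pair x (nat_wedge y)"
  by (simp add: nat_b_eq nat_wedge_def linext_tensor tensor_linext nat_f_def)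

text \<open>Injectivity of \<open>nat_f\<close> is available only on genuine indices, because
  \<open>nat_index\<close> inverts \<open>ket\<close> on partitions. Hence the condition on the
  support, which recurs below.\<close>

lemma nat_hat_nat_f:
  assumes "\<And>f. x f \<noteq> 0 \<Longrightarrow> f \<in> findices b 0" "f \<in> findices b 0"
  shows "nat_hat x (nat_f f) = x f"
proof -
  have "x f' * Poly_Mapping.lookup (nat_b (basis f')) (nat_f f) = (if f' = f then x f else 0)" for f'
  proof (cases "x f' = 0")
    case False
    then have "nat_f f' = nat_f f \<longleftrightarrow> f' = f"
      using assms inj_onD[OF bij_betw_imp_inj_on[OF bij_nat_f]] by blast
    then show ?thesis
      by (simp add: nat_b_eq lookup_single when_def)
  qed auto
  then show ?thesis
    by (simp add: nat_hat_def)
qed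

lemma nat_hat_outside:
  assumes "\<And>f. x f \<noteq> 0 \<Longrightarrow> f \<in> findices b 0" "g \<notin> findices b 1"
  shows "nat_hat x g = 0"
proof -
  have "x f * Poly_Mapping.lookup (nat_b (basis f)) g = 0" for f
    using assms nat_f_findices[of f b]
    by (cases "x f = 0") (auto simp: nat_b_eq lookup_single when_def)
  then show ?thesis
    by (simp only: nat_hat_def Sum_any.neutral)
qed

lemma findices_1E:
  assumes "g \<in> findices b 1"
  obtains f where "f \<in> findices b 0" "g = nat_f f"
  using assms bij_betw_imp_surj_on[OF bij_nat_f] by blast

lemma nat_hat_eqI:
  assumes "\<And>f. x f \<noteq> 0 \<Longrightarrow> f \<in> findices b 0"
    and "\<And>f. f \<in> findices b 0 \<Longrightarrow> y (nat_f f) = x f" "\<And>g. g \<notin> findices b 1 \<Longrightarrow> y g = 0"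
  shows "nat_hat x = y"
proof
  fix g
  show "nat_hat x g = y g"
  proof (cases "g \<in> findices b 1")
    case True
    then obtain f where "f \<in> findices b 0" "g = nat_f f"
      by (rule findices_1E)
    then show ?thesis
      using assms(2) nat_hat_nat_f[OF assms(1)] by simp
  next
    case False
    then show ?thesis
      using assms(3) nat_hat_outside[OF assms(1)] by simp
  qed
qed

text \<open>The inverse of \<open>nat_hat\<close> on functions supported on genuine indices; the
  value 0 elsewhere keeps the result in that class.\<close>

definition nat_pull :: "nat list \<Rightarrow> (findex \<Rightarrow> qfield) \<Rightarrow> (findex \<Rightarrow> qfield)" where
  "nat_pull b y = (\<lambda>f. if f \<in> findices b 0 then y (nat_f f) else 0)"

lemma nat_hat_nat_pull:
  assumes "\<And>g. y g \<noteq> 0 \<Longrightarrow> g \<in> findices b 1"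
  shows "nat_hat (nat_pull b y) = y"
  by (rule nat_hat_eqI[of _ b]) (use assms in \<open>auto simp: nat_pull_def split: if_splits\<close>)

lemma nat_pull_nat_hat:
  assumes "\<And>f. x f \<noteq> 0 \<Longrightarrow> f \<in> findices b 0"
  shows "nat_pull b (nat_hat x) = x"
  using assms nat_hat_nat_f[of x b] by (fastforce simp: nat_pull_def)

lemma unitriangular_at_support:
  "unitriangular_at b \<epsilon> f x \<Longrightarrow> x g \<noteq> 0 \<Longrightarrow> g \<in> findices b \<epsilon>"
  unfolding unitriangular_at_def by blast

lemma unitriangular_at_bruhat:
  "unitriangular_at b \<epsilon> f x \<Longrightarrow> x g \<noteq> 0 \<Longrightarrow> bruhat b \<epsilon> g f"
  unfolding unitriangular_at_def by blast

lemma unitriangular_at_nat_hat: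
  assumes "unitriangular_at b 0 f x" "f \<in> findices b 0"
  shows "unitriangular_at b 1 (nat_f f) (nat_hat x)"
proof -
  note supp = unitriangular_at_support[OF assms(1)]
  have "g \<in> findices b 1 \<and> bruhat b 1 g (nat_f f)" if "nat_hat x g \<noteq> 0" for g
  proof -
    have "g \<in> findices b 1"
      using that nat_hat_outside[OF supp] by blast
    moreover from this obtain k where k: "k \<in> findices b 0" "g = nat_f k"
      by (rule findices_1E)
    then have "bruhat b 0 k f"
      using that nat_hat_nat_f[OF supp k(1)] by (intro unitriangular_at_bruhat[OF assms(1)]) simp
    ultimately show ?thesis
      using bruhat_nat_f assms(2) k by simp
  qed
  moreover have "nat_hat x (nat_f f) = 1"
    using assms nat_hat_nat_f[OF supp] by (simp add: unitriangular_at_def)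
  ultimately show ?thesis
    by (simp add: unitriangular_at_def)
qed

lemma unitriangular_at_nat_pull:
  assumes "unitriangular_at b 1 (nat_f f) y" "f \<in> findices b 0"
  shows "unitriangular_at b 0 f (nat_pull b y)"
  unfolding unitriangular_at_def
proof (intro conjI allI impI)
  show "nat_pull b y f = 1"
    using assms by (simp add: nat_pull_def unitriangular_at_def)
  fix g assume "nat_pull b y g \<noteq> 0"
  then have "g \<in> findices b 0" "y (nat_f g) \<noteq> 0"
    by (auto simp: nat_pull_def split: if_splits)
  then show "g \<in> findices b 0" "bruhat b 0 g f"
    using unitriangular_at_bruhat[OF assms(1)] bruhat_nat_f[OF assms(2)] by blast+
qed

section \<open>The isomorphism of the B-completions\<close>

lemma B_completion_support:
  assumes "x \<in> B_completion b \<epsilon>" "x g \<noteq> 0"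
  shows "g \<in> findices b \<epsilon>"
proof -
  obtain X c where X: "x = (\<lambda>g. \<Sum>x\<in>X. c x * x g)" "\<forall>x\<in>X. \<exists>f\<in>findices b \<epsilon>. unitriangular_at b \<epsilon> f x"
    using assms(1) by (auto simp: B_completion_def)
  then obtain y where "y \<in> X" "y g \<noteq> 0"
    using assms(2) by (metis (no_types, lifting) mult_eq_0_iff sum.neutral)
  then show ?thesis
    using X(2) unitriangular_at_support by blast
qed

lemma sum_in_B_completion:
  assumes "finite I" "\<And>i. i \<in> I \<Longrightarrow> \<exists>f\<in>findices b \<epsilon>. unitriangular_at b \<epsilon> f (\<phi> i)"
  shows "(\<lambda>g. \<Sum>i\<in>I. c i * \<phi> i g) \<in> B_completion b \<epsilon>"
proof -
  \<comment> \<open>Coefficients in \<open>B_completion\<close> are attached to vectors, not to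
    labels, so those of labels with the same vector are merged.\<close>
  define d where "d x = (\<Sum>i\<in>{i \<in> I. \<phi> i = x}. c i)" for x
  have "(\<Sum>i\<in>I. c i * \<phi> i g) = (\<Sum>x\<in>\<phi> ` I. d x * x g)" for g
    unfolding sum.image_gen[OF assms(1), of "\<lambda>i. c i * \<phi> i g" \<phi>] d_def sum_distrib_right
    by (intro sum.cong) auto
  then show ?thesis
    using assms unfolding B_completion_def mem_Collect_eq
    by (intro exI[of _ "\<phi> ` I"] exI[of _ d]) auto
qed

lemma nat_hat_sum:
  assumes "\<And>i f. i \<in> I \<Longrightarrow> \<phi> i f \<noteq> 0 \<Longrightarrow> f \<in> findices b 0"
  shows "nat_hat (\<lambda>g. \<Sum>i\<in>I. c i * \<phi> i g) = (\<lambda>g. \<Sum>i\<in>I. c i * nat_hat (\<phi> i) g)"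
proof (rule nat_hat_eqI)
  fix f assume "(\<Sum>i\<in>I. c i * \<phi> i f) \<noteq> 0"
  then obtain i where "i \<in> I" "\<phi> i f \<noteq> 0"
    by (metis (no_types, lifting) mult_eq_0_iff sum.neutral)
  then show "f \<in> findices b 0"
    using assms by blast
next
  fix f assume "f \<in> findices b 0"
  then show "(\<Sum>i\<in>I. c i * nat_hat (\<phi> i) (nat_f f)) = (\<Sum>i\<in>I. c i * \<phi> i f)"
    using assms by (intro sum.cong) (simp_all add: nat_hat_nat_f[of _ b])
next
  fix g assume "g \<notin> findices b 1"
  then show "(\<Sum>i\<in>I. c i * nat_hat (\<phi> i) g) = 0"
    using assms by (intro sum.neutral) (simp add: nat_hat_outside[of _ b])
qed

lemma bij_nat_hat: "bij_betw nat_hat (B_completion b 0) (B_completion b 1)"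
proof (rule bij_betw_byWitness[where f' = "nat_pull b"])
  show "\<forall>x\<in>B_completion b 0. nat_pull b (nat_hat x) = x"
    using nat_pull_nat_hat B_completion_support by blast
  show "\<forall>y\<in>B_completion b 1. nat_hat (nat_pull b y) = y"
    using nat_hat_nat_pull B_completion_support by blast
  show "nat_hat ` B_completion b 0 \<subseteq> B_completion b 1"
  proof (rule image_subsetI)
    fix x assume "x \<in> B_completion b 0"
    then obtain X c where X: "x = (\<lambda>g. \<Sum>x\<in>X. c x * x g)" "finite X"
        "\<forall>x\<in>X. \<exists>f\<in>findices b 0. unitriangular_at b 0 f x"
      by (auto simp: B_completion_def)
    have "nat_hat x = (\<lambda>g. \<Sum>x\<in>X. c x * nat_hat x g)"
      unfolding X(1) using X(3) unitriangular_at_support by (intro nat_hat_sum[of _ _ b]) blast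
    moreover have "\<exists>f\<in>findices b 1. unitriangular_at b 1 f (nat_hat y)" if "y \<in> X" for y
      using X(3) that unitriangular_at_nat_hat nat_f_findices by blast
    ultimately show "nat_hat x \<in> B_completion b 1"
      using sum_in_B_completion[OF X(2), of b 1 nat_hat c] by simp
  qed
  show "nat_pull b ` B_completion b 1 \<subseteq> B_completion b 0"
  proof (rule image_subsetI)
    fix y assume "y \<in> B_completion b 1"
    then obtain Y c where Y: "y = (\<lambda>g. \<Sum>y\<in>Y. c y * y g)" "finite Y"
        "\<forall>y\<in>Y. \<exists>f\<in>findices b 1. unitriangular_at b 1 f y"
      unfolding B_completion_def by blast
    have "nat_pull b y = (\<lambda>g. \<Sum>y\<in>Y. c y * nat_pull b y g)"
      by (auto simp: Y(1) nat_pull_def)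
    moreover have "\<exists>f\<in>findices b 0. unitriangular_at b 0 f (nat_pull b z)" if "z \<in> Y" for z
      using Y(3) that unitriangular_at_nat_pull findices_1E by metis
    ultimately show "nat_pull b y \<in> B_completion b 0"
      using sum_in_B_completion[OF Y(2), of b 0 "nat_pull b" c] by simp
  qed
qed

lemma nat_hat_linear:
  assumes "x \<in> B_completion b 0" "y \<in> B_completion b 0"
  shows "nat_hat (\<lambda>g. c * x g + d * y g) = (\<lambda>g. c * nat_hat x g + d * nat_hat y g)"
proof (rule nat_hat_eqI)
  note x = B_completion_support[OF assms(1)] and y = B_completion_support[OF assms(2)]
  show "f \<in> findices b 0" if "c * x f + d * y f \<noteq> 0" for f
    using that x[of f] y[of f] by (cases "x f = 0") auto
  show "f \<in> findices b 0 \<Longrightarrow> c * nat_hat x (nat_f f) + d * nat_hat y (nat_f f) = c * x f + d * y f" for f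
    using nat_hat_nat_f[OF x] nat_hat_nat_f[OF y] by simp
  show "g \<notin> findices b 1 \<Longrightarrow> c * nat_hat x g + d * nat_hat y g = 0" for g
    using nat_hat_outside[OF x] nat_hat_outside[OF y] by simp
qed

lemma lookup_nat_b:
  assumes "Poly_Mapping.keys z \<subseteq> findices b 0" "f \<in> findices b 0"
  shows "Poly_Mapping.lookup (nat_b z) (nat_f f) = Poly_Mapping.lookup z f"
  unfolding nat_b_eq using bij_betw_imp_inj_on[OF bij_nat_f] assms
  by (rule lookup_linext_basis_inj)

lemma nat_hat_lookup:
  assumes "Poly_Mapping.keys z \<subseteq> findices b 0"
  shows "nat_hat (Poly_Mapping.lookup z) = Poly_Mapping.lookup (nat_b z)"
proof (rule nat_hat_eqI)
  show "Poly_Mapping.lookup z f \<noteq> 0 \<Longrightarrow> f \<in> findices b 0" for f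
    using assms by (auto simp: in_keys_iff)
  show "Poly_Mapping.lookup (nat_b z) g = 0" if "g \<notin> findices b 1" for g
  proof (rule ccontr)
    assume "Poly_Mapping.lookup (nat_b z) g \<noteq> 0"
    then have "g \<in> Poly_Mapping.keys (linext (\<lambda>f. basis (nat_f f)) z)"
      by (simp add: in_keys_iff nat_b_eq)
    then obtain f where "f \<in> Poly_Mapping.keys z" "g = nat_f f"
      by (rule keys_linextE) simp
    with assms nat_f_findices that show False
      by blast
  qed
qed (rule lookup_nat_b[OF assms])

lemma nat_hat_std:
  assumes "f \<in> findices b 0"
  shows "nat_hat (std f) = std (nat_f f)"
proof -
  have std: "std k = Poly_Mapping.lookup (basis k)" for k
    by (auto simp: std_def lookup_single when_def)
  have "nat_hat (Poly_Mapping.lookup (basis f)) = Poly_Mapping.lookup (nat_b (basis f))"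
    using assms by (intro nat_hat_lookup[of _ b]) simp
  then show ?thesis
    by (simp add: std nat_b_eq)
qed


section \<open>Compatibility with the bar involutions\<close>

lemma word_act_nat_wedge:
  assumes "h \<in> Zinf 0"
  shows "set ls \<subseteq> range GF \<Longrightarrow> word_act (wedge_mod 1) (FMon ls) (basis (nat_index h)) =
    nat_wedge (word_act (wedge_mod 0) (FMon ls) (basis h))"
proof (induction ls)
  case Nil
  then show ?case
    by (simp add: nat_wedge_def)
next
  case (Cons l ls)
  then obtain a where a: "l = GF a"
    by auto
  let ?y = "word_act (wedge_mod 0) (FMon ls) (basis h)"
  \<comment> \<open>Words in the \<open>F_a\<close> do not leave the genuine wedges, the domain on
    which the intertwining of a single \<open>F_a\<close> is known.\<close>
  have keys: "k \<in> Zinf 0" if "k \<in> Poly_Mapping.keys ?y" for k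
    using keys_wedge_mod_neg_word[OF assms _ that] Cons.prems by auto
  have "word_act (wedge_mod 1) (FMon (l # ls)) (basis (nat_index h)) =
      linext (wedge_mod 1 (GF a)) (nat_wedge ?y)"
    using Cons by (simp add: a)
  also have "\<dots> = linext (\<lambda>k. wedge_mod 1 (GF a) (nat_index k)) ?y"
    by (simp add: nat_wedge_def linext_linext)
  also have "\<dots> = linext (\<lambda>k. nat_wedge (wedge_mod 0 (GF a) k)) ?y"
    unfolding nat_wedge_def using keys by (intro linext_cong refl wedge_mod_GF_nat_index)
  also have "\<dots> = nat_wedge (word_act (wedge_mod 0) (FMon (l # ls)) (basis h))"
    by (simp add: nat_wedge_def linext_linext a)
  finally show ?case .
qed

text \<open>The module \<rho> is arbitrary since \<open>nat_b\<close> touches only the wedge, where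
  every term of the quasi-R-matrix acts by a word in the \<open>F_a\<close>.\<close>

lemma act2_nat_b:
  assumes "quasi_R_matrix k \<Theta>" "h \<in> Zinf 0"
  shows "act2 Pair \<rho> (wedge_mod 1) (\<Theta> \<mu>) x (basis (nat_index h)) =
    nat_b (act2 Pair \<rho> (wedge_mod 0) (\<Theta> \<mu>) x (basis h))"
proof -
  have "tensor Pair (word_act \<rho> w x) (word_act (wedge_mod 1) w' (basis (nat_index h))) =
      nat_b (tensor Pair (word_act \<rho> w x) (word_act (wedge_mod 0) w' (basis h)))"
    if w: "(w, w') \<in> Poly_Mapping.keys (\<Theta> \<mu>)" for w w'
  proof -
    obtain ls where ls: "w' = FMon ls" "set ls \<subseteq> GF ` sub_roots k"
      using quasi_R_matrix_keys[OF assms(1) w] by metis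
    then have "set ls \<subseteq> range GF"
      by blast
    then show ?thesis
      by (simp only: ls(1) word_act_nat_wedge[OF assms(2)] nat_b_tensor)
  qed
  then show ?thesis
    unfolding act2_def nat_b_eq linext_sum
    by (intro sum.cong) (auto simp: linext_scal)
qed

lemma psi_nat_f:
  assumes "quasi_R_matrix k \<Theta>" "set b \<subseteq> {0, 1}" "f \<in> findices b 0"
  shows "psi \<Theta> b 1 (nat_f f) = nat_b (psi \<Theta> b 0 f)"
proof (cases "b = []")
  case True
  then show ?thesis
    by (simp add: psi_def nat_b_eq)
next
  case False
  let ?x = "psi_fin \<Theta> b (length b) (fst f)"
  have len: "length (fst f) = length b" and snd_f: "snd f \<in> Zinf 0"
    using assms(3) by (auto simp: findices_def)
  have fin: "finite {\<mu>. act2 Pair (T_mod b (length b)) (wedge_mod 0) (\<Theta> \<mu>) ?x (basis (snd f)) \<noteq> 0}"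
    by (rule finite_quasi_R_support[OF assms(1,2) order_refl psi_fin_keys(2)[OF assms(1,2) len]])
  have "psi \<Theta> b 1 (nat_f f) =
      Sum_any (\<lambda>\<mu>. nat_b (act2 Pair (T_mod b (length b)) (wedge_mod 0) (\<Theta> \<mu>) ?x (basis (snd f))))"
    using False
    by (simp add: psi_def Theta_act_def nat_f_def act2_nat_b[OF assms(1) snd_f] del: One_nat_def)
  also have "\<dots> = nat_b (psi \<Theta> b 0 f)"
    using False by (simp add: psi_def Theta_act_def nat_b_eq) (rule linext_Sum_any[OF fin, symmetric])
  finally show ?thesis .
qed

context
  fixes \<Theta> :: "nat \<Rightarrow> (int \<Rightarrow>\<^sub>0 int) \<Rightarrow> uqfree2" and b :: "nat list"
  assumes quasi_R: "\<And>k. k \<ge> 1 \<Longrightarrow> quasi_R_matrix k (\<Theta> k)" and seq: "set b \<subseteq> {0, 1}"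
begin

lemma bar_coeff_eqI:
  assumes "\<And>k. k \<ge> 1 \<Longrightarrow> Poly_Mapping.lookup (psi (\<Theta> k) b \<epsilon> f) g = c"
  shows "bar_coeff \<Theta> b \<epsilon> g f = c"
  unfolding bar_coeff_def
proof (rule the_equality)
  show ev: "\<forall>\<^sub>F l in sequentially. Poly_Mapping.lookup (psi (\<Theta> l) b \<epsilon> f) g = c"
    using eventually_ge_at_top[of 1] by eventually_elim (rule assms)
  fix d assume "\<forall>\<^sub>F l in sequentially. Poly_Mapping.lookup (psi (\<Theta> l) b \<epsilon> f) g = d"
  with ev have "\<forall>\<^sub>F l :: nat in sequentially. d = c"
    by eventually_elim simp
  then show "d = c"
    by simp
qed

lemma bar_coeff_not_bruhat:
  assumes "\<epsilon> \<in> {0, 1}" "f \<in> findices b \<epsilon>" "\<not> (g \<in> findices b \<epsilon> \<and> bruhat b \<epsilon> g f)"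
  shows "bar_coeff \<Theta> b \<epsilon> g f = 0"
proof (rule bar_coeff_eqI)
  fix k :: nat assume "k \<ge> 1"
  from psi_unitriangular(1)[OF quasi_R[OF this] seq assms(1,2), of g] assms(3)
  show "Poly_Mapping.lookup (psi (\<Theta> k) b \<epsilon> f) g = 0"
    by (meson in_keys_iff)
qed

lemma bar_coeff_diag:
  assumes "\<epsilon> \<in> {0, 1}" "f \<in> findices b \<epsilon>"
  shows "bar_coeff \<Theta> b \<epsilon> f f = 1"
  using psi_unitriangular(2)[OF quasi_R seq assms] by (rule bar_coeff_eqI)

lemma bar_coeff_nat_f:
  assumes "f \<in> findices b 0" "g \<in> findices b 0"
  shows "bar_coeff \<Theta> b 1 (nat_f g) (nat_f f) = bar_coeff \<Theta> b 0 g f"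
proof -
  have "Poly_Mapping.lookup (psi (\<Theta> l) b 1 (nat_f f)) (nat_f g) =
      Poly_Mapping.lookup (psi (\<Theta> l) b 0 f) g" if "l \<ge> 1" for l
  proof -
    have "Poly_Mapping.keys (psi (\<Theta> l) b 0 f) \<subseteq> findices b 0"
      using psi_unitriangular(1)[OF quasi_R[OF that] seq _ assms(1)] by blast
    then show ?thesis
      using psi_nat_f[OF quasi_R[OF that] seq assms(1)] lookup_nat_b[OF _ assms(2)] by simp
  qed
  \<comment> \<open>The predicates under the definite descriptions agree for every c, so the two
    coefficients coincide without any limit being computed.\<close>
  then have "(\<forall>\<^sub>F l in sequentially. Poly_Mapping.lookup (psi (\<Theta> l) b 1 (nat_f f)) (nat_f g) = c) \<longleftrightarrow>
      (\<forall>\<^sub>F l in sequentially. Poly_Mapping.lookup (psi (\<Theta> l) b 0 f) g = c)" for c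
    by (intro eventually_cong[OF eventually_ge_at_top[of 1]]) simp
  then show ?thesis
    by (simp add: bar_coeff_def)
qed

lemma nat_hat_bar_map:
  assumes "\<And>f. x f \<noteq> 0 \<Longrightarrow> f \<in> findices b 0"
  shows "nat_hat (bar_map \<Theta> b 0 x) = bar_map \<Theta> b 1 (nat_hat x)"
proof (rule nat_hat_eqI)
  show "f \<in> findices b 0" if "bar_map \<Theta> b 0 x f \<noteq> 0" for f
  proof (rule ccontr)
    assume "f \<notin> findices b 0"
    then have "qbar (x k) * bar_coeff \<Theta> b 0 f k = 0" for k
      using bar_coeff_not_bruhat[of 0 k f] assms[of k] by (cases "x k = 0") auto
    with that show False
      by (simp add: bar_map_def)
  qed
next
  fix g assume g: "g \<in> findices b 0"
  let ?\<phi> = "\<lambda>f. qbar (x f) * bar_coeff \<Theta> b 0 g f"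
  let ?\<psi> = "\<lambda>f. qbar (nat_hat x f) * bar_coeff \<Theta> b 1 (nat_f g) f"
  have eq: "?\<psi> (nat_f f) = ?\<phi> f" if "f \<in> findices b 0" for f
    using that g nat_hat_nat_f[OF assms] bar_coeff_nat_f by simp
  have supp: "{f. ?\<phi> f \<noteq> 0} \<subseteq> findices b 0"
  proof
    fix f assume "f \<in> {f. ?\<phi> f \<noteq> 0}"
    then have "x f \<noteq> 0"
      by auto
    then show "f \<in> findices b 0"
      by (rule assms)
  qed
  \<comment> \<open>The supports correspond bijectively, so the two sums agree even when they are
    infinite: both then take the default value 0.\<close>
  have "{k. ?\<psi> k \<noteq> 0} = nat_f ` {f. ?\<phi> f \<noteq> 0}"
  proof (intro equalityI subsetI)
    fix k assume k: "k \<in> {k. ?\<psi> k \<noteq> 0}"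
    then have "nat_hat x k \<noteq> 0"
      by auto
    then have "k \<in> findices b 1"
      using nat_hat_outside[OF assms] by blast
    then obtain f where f: "f \<in> findices b 0" "k = nat_f f"
      by (rule findices_1E)
    have "?\<phi> f \<noteq> 0"
      using k unfolding mem_Collect_eq f(2) eq[OF f(1)] .
    then show "k \<in> nat_f ` {f. ?\<phi> f \<noteq> 0}"
      using f(2) by blast
  qed (use eq supp in force)
  moreover have "inj_on nat_f {f. ?\<phi> f \<noteq> 0}"
    using bij_betw_imp_inj_on[OF bij_nat_f] supp by (rule inj_on_subset)
  ultimately have "Sum_any ?\<psi> = (\<Sum>f | ?\<phi> f \<noteq> 0. ?\<psi> (nat_f f))"
    by (simp only: Sum_any.expand_set sum.reindex o_def)
  also have "\<dots> = Sum_any ?\<phi>"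
    unfolding Sum_any.expand_set using eq supp by (intro sum.cong refl) blast
  finally show "bar_map \<Theta> b 1 (nat_hat x) (nat_f g) = bar_map \<Theta> b 0 x g"
    by (simp add: bar_map_def)
next
  fix g assume "g \<notin> findices b 1"
  then have "qbar (nat_hat x k) * bar_coeff \<Theta> b 1 g k = 0" for k
    using bar_coeff_not_bruhat[of 1 k g] nat_hat_outside[of x b k, OF assms]
    by (cases "nat_hat x k = 0") auto
  then show "bar_map \<Theta> b 1 (nat_hat x) g = 0"
    by (simp only: bar_map_def Sum_any.neutral)
qed


section \<open>Canonical bases\<close>

text \<open>The coefficients of x cut off the indices not below f, the bar coefficients those not
  above g. The diagonal term is split off for the comparison at a maximal index.\<close>

lemma bar_map_at:
  assumes x: "unitriangular_at b 1 f x" and f: "f \<in> findices b 1" and g: "g \<in> findices b 1"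
    "bruhat b 1 g f"
  shows "bar_map \<Theta> b 1 x g = qbar (x g) +
    (\<Sum>k\<in>{k \<in> findices b 1. bruhat b 1 g k \<and> bruhat b 1 k f} - {g}. qbar (x k) * bar_coeff \<Theta> b 1 g k)"
proof -
  let ?I = "{k \<in> findices b 1. bruhat b 1 g k \<and> bruhat b 1 k f}"
  have fin: "finite ?I"
    by (rule finite_bruhat_interval[OF f g(1)])
  have "k \<in> ?I" if "qbar (x k) * bar_coeff \<Theta> b 1 g k \<noteq> 0" for k
  proof -
    have "x k \<noteq> 0"
      using that by auto
    then have k: "k \<in> findices b 1" "bruhat b 1 k f"
      using unitriangular_at_support[OF x] unitriangular_at_bruhat[OF x] by blast+
    then show ?thesis
      using that bar_coeff_not_bruhat[of 1 k g] by auto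
  qed
  then have "bar_map \<Theta> b 1 x g = (\<Sum>k\<in>?I. qbar (x k) * bar_coeff \<Theta> b 1 g k)"
    unfolding bar_map_def using fin by (intro Sum_any.expand_superset) blast+
  also have "\<dots> = qbar (x g) * bar_coeff \<Theta> b 1 g g +
      (\<Sum>k\<in>?I - {g}. qbar (x k) * bar_coeff \<Theta> b 1 g k)"
    using fin g bruhat_refl by (intro sum.remove) auto
  also have "bar_coeff \<Theta> b 1 g g = 1"
    using g(1) by (intro bar_coeff_diag) auto
  finally show ?thesis
    by simp
qed

lemma bar_invariant_unique:
  assumes R: "\<And>x y. x \<in> R \<Longrightarrow> y \<in> R \<Longrightarrow> x - y = qbar x - qbar y \<Longrightarrow> x = y"
    and f: "f \<in> findices b 1"
    and X: "unitriangular_at b 1 f X" "bar_map \<Theta> b 1 X = X"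
      "\<And>g. g \<in> findices b 1 \<Longrightarrow> bruhat b 1 g f \<Longrightarrow> g \<noteq> f \<Longrightarrow> X g \<in> R"
    and Y: "unitriangular_at b 1 f Y" "bar_map \<Theta> b 1 Y = Y"
      "\<And>g. g \<in> findices b 1 \<Longrightarrow> bruhat b 1 g f \<Longrightarrow> g \<noteq> f \<Longrightarrow> Y g \<in> R"
  shows "X = Y"
proof (rule ccontr)
  assume "X \<noteq> Y"
  then obtain g0 where g0: "X g0 \<noteq> Y g0"
    by (meson ext)
  then have "X g0 \<noteq> 0 \<or> Y g0 \<noteq> 0"
    by auto
  then have g0_le: "g0 \<in> findices b 1" "bruhat b 1 g0 f"
    using unitriangular_at_support[OF X(1)] unitriangular_at_support[OF Y(1)]
      unitriangular_at_bruhat[OF X(1)] unitriangular_at_bruhat[OF Y(1)] by blast+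
  \<comment> \<open>The set of all differing indices may be infinite; restricting to those above one
    of them places it inside a finite interval.\<close>
  let ?S = "{k \<in> findices b 1. bruhat b 1 g0 k \<and> bruhat b 1 k f \<and> X k \<noteq> Y k}"
  let ?less = "\<lambda>k l. bruhat b 1 k l \<and> k \<noteq> l"
  have "?S \<subseteq> {k \<in> findices b 1. bruhat b 1 g0 k \<and> bruhat b 1 k f}"
    by blast
  then have "finite ?S"
    using finite_bruhat_interval[OF f g0_le(1)] by (rule finite_subset)
  moreover have "asymp_on ?S ?less"
    using bruhat_antisym[of _ b 1] by (intro asymp_onI) blast
  moreover have "transp_on ?S ?less"
    using bruhat_antisym[of _ b 1] bruhat_trans[of _ b 1] by (intro transp_onI) blast
  moreover have "?S \<noteq> {}"
    using g0 g0_le bruhat_refl by blast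
  ultimately obtain g where g: "g \<in> ?S" and max: "\<forall>k\<in>?S. k \<noteq> g \<longrightarrow> \<not> ?less g k"
    using Finite_Set.bex_max_element[of ?S ?less] by blast
  let ?I = "{k \<in> findices b 1. bruhat b 1 g k \<and> bruhat b 1 k f}"
  \<comment> \<open>Such k also lies above g0 by transitivity, so maximality of g in
    \<open>?S\<close> applies to it.\<close>
  have "X k = Y k" if "k \<in> ?I - {g}" for k
  proof (rule ccontr)
    assume "X k \<noteq> Y k"
    moreover have "bruhat b 1 g0 k"
      using bruhat_trans[of k b 1 g g0] that g g0_le by auto
    ultimately show False
      using max that by blast
  qed
  then have "(\<Sum>k\<in>?I - {g}. qbar (X k) * bar_coeff \<Theta> b 1 g k) =
      (\<Sum>k\<in>?I - {g}. qbar (Y k) * bar_coeff \<Theta> b 1 g k)"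
    by (intro sum.cong) simp_all
  then have "X g - Y g = qbar (X g) - qbar (Y g)"
    using bar_map_at[OF X(1) f, of g] bar_map_at[OF Y(1) f, of g] g unfolding X(2) Y(2) by simp
  \<comment> \<open>Both coefficients at f are 1, so the disagreement at g is off the diagonal,
    where the coefficients lie in R.\<close>
  moreover have "g \<noteq> f"
    using g X(1) Y(1) by (auto simp: unitriangular_at_def)
  then have "X g \<in> R" "Y g \<in> R"
    using X(3) Y(3) g by auto
  ultimately show False
    using R g by blast
qed

text \<open>The carried-over element satisfies every condition that characterizes its counterpart,
  so uniqueness on the side of increasing wedges identifies the two.\<close>

lemma bar_invariant_basis_nat_hat:
  assumes R: "\<And>x y. x \<in> R \<Longrightarrow> y \<in> R \<Longrightarrow> x - y = qbar x - qbar y \<Longrightarrow> x = y"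
    and X0: "bar_invariant_basis R \<Theta> b 0 X0" and X1: "bar_invariant_basis R \<Theta> b 1 X1"
    and f: "f \<in> findices b 0"
  shows "nat_hat (X0 f) = X1 (nat_f f)"
proof -
  have x0: "X0 f \<in> B_completion b 0" "bar_map \<Theta> b 0 (X0 f) = X0 f" "unitriangular_at b 0 f (X0 f)"
    "\<And>g. g \<in> findices b 0 \<Longrightarrow> bruhat b 0 g f \<Longrightarrow> g \<noteq> f \<Longrightarrow> X0 f g \<in> R"
    using X0 f unfolding bar_invariant_basis_def by blast+
  note supp = unitriangular_at_support[OF x0(3)]
  have f1: "nat_f f \<in> findices b 1"
    by (rule nat_f_findices[OF f])
  have x1: "bar_map \<Theta> b 1 (X1 (nat_f f)) = X1 (nat_f f)" "unitriangular_at b 1 (nat_f f) (X1 (nat_f f))"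
    "\<And>g. g \<in> findices b 1 \<Longrightarrow> bruhat b 1 g (nat_f f) \<Longrightarrow> g \<noteq> nat_f f \<Longrightarrow> X1 (nat_f f) g \<in> R"
    using X1 f1 unfolding bar_invariant_basis_def by blast+
  show ?thesis
  proof (rule bar_invariant_unique[OF R f1 _ _ _ x1(2) x1(1) x1(3)])
    show "unitriangular_at b 1 (nat_f f) (nat_hat (X0 f))"
      by (rule unitriangular_at_nat_hat[OF x0(3) f])
    show "bar_map \<Theta> b 1 (nat_hat (X0 f)) = nat_hat (X0 f)"
      using nat_hat_bar_map[of "X0 f", OF supp] x0(2) by simp
    show "nat_hat (X0 f) g \<in> R"
      if g: "g \<in> findices b 1" "bruhat b 1 g (nat_f f)" "g \<noteq> nat_f f" for g
    proof -
      obtain k where k: "k \<in> findices b 0" "g = nat_f k"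
        using g(1) by (rule findices_1E)
      then have "bruhat b 0 k f" "k \<noteq> f"
        using g bruhat_nat_f[OF f k(1)] by auto
      then show ?thesis
        using x0(4)[OF k(1)] nat_hat_nat_f[of "X0 f" b k, OF supp k(1)] k(2) by simp
    qed
  qed
qed

lemma bar_invariant_basis_coeff:
  assumes R: "\<And>x y. x \<in> R \<Longrightarrow> y \<in> R \<Longrightarrow> x - y = qbar x - qbar y \<Longrightarrow> x = y"
    and X0: "bar_invariant_basis R \<Theta> b 0 X0" and X1: "bar_invariant_basis R \<Theta> b 1 X1"
    and f: "f \<in> findices b 0" and g: "g \<in> findices b 0"
  shows "X0 f g = X1 (nat_f f) (nat_f g)"
proof -
  have "unitriangular_at b 0 f (X0 f)"
    using X0 f unfolding bar_invariant_basis_def by blast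
  then have "nat_hat (X0 f) (nat_f g) = X0 f g"
    using g unitriangular_at_support by (intro nat_hat_nat_f)
  moreover have "nat_hat (X0 f) = X1 (nat_f f)"
    by (rule bar_invariant_basis_nat_hat[where R = R]) (fact R X0 X1 f)+
  ultimately show ?thesis
    by simp
qed

end

theorem theorem4p8:
  fixes m n :: nat and b :: "nat list"
    and \<Theta> :: "nat \<Rightarrow> (int \<Rightarrow>\<^sub>0 int) \<Rightarrow> uqfree2"
  assumes "zero_one_seq m n b"
    and "\<And>k. k \<ge> 1 \<Longrightarrow> quasi_R_matrix k (\<Theta> k)"
  shows
    "(\<forall>f\<in>findices b 0. \<forall>g\<in>findices b 0.
        bruhat b 0 g f \<longleftrightarrow> bruhat b 1 (nat_f g) (nat_f f)) \<and>
     bij_betw nat_hat (B_completion b 0) (B_completion b 1) \<and>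
     (\<forall>x\<in>B_completion b 0. \<forall>y\<in>B_completion b 0. \<forall>c d.
        nat_hat (\<lambda>g. c * x g + d * y g) = (\<lambda>g. c * nat_hat x g + d * nat_hat y g)) \<and>
     (\<forall>z. Poly_Mapping.keys z \<subseteq> findices b 0 \<longrightarrow>
        nat_hat (Poly_Mapping.lookup z) = Poly_Mapping.lookup (nat_b z)) \<and>
     (\<forall>x\<in>B_completion b 0. nat_hat (bar_map \<Theta> b 0 x) = bar_map \<Theta> b 1 (nat_hat x)) \<and>
     (\<forall>f\<in>findices b 0. nat_f f \<in> findices b 1 \<and> nat_hat (std f) = std (nat_f f)) \<and>
     (\<forall>T0 T1. canonical_basis \<Theta> b 0 T0 \<and> canonical_basis \<Theta> b 1 T1 \<longrightarrow>
        (\<forall>f\<in>findices b 0. nat_hat (T0 f) = T1 (nat_f f)) \<and>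
        (\<forall>g\<in>findices b 0. \<forall>f\<in>findices b 0. T0 f g = T1 (nat_f f) (nat_f g))) \<and>
     (\<forall>L0 L1. dual_canonical_basis \<Theta> b 0 L0 \<and> dual_canonical_basis \<Theta> b 1 L1 \<longrightarrow>
        (\<forall>f\<in>findices b 0. nat_hat (L0 f) = L1 (nat_f f)) \<and>
        (\<forall>g\<in>findices b 0. \<forall>f\<in>findices b 0. L0 f g = L1 (nat_f f) (nat_f g)))"
proof -
  have seq: "set b \<subseteq> {0, 1}"
    using assms(1) by (simp add: zero_one_seq_def)
  have bar: "nat_hat (bar_map \<Theta> b 0 x) = bar_map \<Theta> b 1 (nat_hat x)"
    if "x \<in> B_completion b 0" for x
    by (rule nat_hat_bar_map[where \<Theta> = \<Theta> and b = b and x = x])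
       (fact assms(2) seq B_completion_support[OF that])+
  \<comment> \<open>Both kinds of bases are treated at once: the coefficient set R enters only
    through the implication that elements with a bar-fixed difference are equal.\<close>
  have bases: "(\<forall>f\<in>findices b 0. nat_hat (X0 f) = X1 (nat_f f)) \<and>
      (\<forall>g\<in>findices b 0. \<forall>f\<in>findices b 0. X0 f g = X1 (nat_f f) (nat_f g))"
    if R: "\<And>x y. x \<in> R \<Longrightarrow> y \<in> R \<Longrightarrow> x - y = qbar x - qbar y \<Longrightarrow> x = y"
      and X: "bar_invariant_basis R \<Theta> b 0 X0 \<and> bar_invariant_basis R \<Theta> b 1 X1" for R X0 X1
  proof (intro conjI ballI)
    fix f assume f: "f \<in> findices b 0"
    show "nat_hat (X0 f) = X1 (nat_f f)"
      by (rule bar_invariant_basis_nat_hat[where \<Theta> = \<Theta> and b = b and R = R])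
         (fact assms(2) seq R conjunct1[OF X] conjunct2[OF X] f)+
  next
    fix g f assume g: "g \<in> findices b 0" and f: "f \<in> findices b 0"
    show "X0 f g = X1 (nat_f f) (nat_f g)"
      by (rule bar_invariant_basis_coeff[where \<Theta> = \<Theta> and b = b and R = R])
         (fact assms(2) seq R conjunct1[OF X] conjunct2[OF X] f g)+
  qed
  show ?thesis
  proof (intro conjI)
    show "\<forall>f\<in>findices b 0. \<forall>g\<in>findices b 0. bruhat b 0 g f \<longleftrightarrow> bruhat b 1 (nat_f g) (nat_f f)"
      by (intro ballI bruhat_nat_f[symmetric])
    show "\<forall>x\<in>B_completion b 0. \<forall>y\<in>B_completion b 0. \<forall>c d.
        nat_hat (\<lambda>g. c * x g + d * y g) = (\<lambda>g. c * nat_hat x g + d * nat_hat y g)"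
      by (intro ballI allI nat_hat_linear)
    show "\<forall>f\<in>findices b 0. nat_f f \<in> findices b 1 \<and> nat_hat (std f) = std (nat_f f)"
      by (intro ballI conjI nat_f_findices nat_hat_std)
    show "\<forall>x\<in>B_completion b 0. nat_hat (bar_map \<Theta> b 0 x) = bar_map \<Theta> b 1 (nat_hat x)"
      by (intro ballI bar)
    show "\<forall>z. Poly_Mapping.keys z \<subseteq> findices b 0 \<longrightarrow>
        nat_hat (Poly_Mapping.lookup z) = Poly_Mapping.lookup (nat_b z)"
      by (intro allI impI nat_hat_lookup)
    show "\<forall>T0 T1. canonical_basis \<Theta> b 0 T0 \<and> canonical_basis \<Theta> b 1 T1 \<longrightarrow>
        (\<forall>f\<in>findices b 0. nat_hat (T0 f) = T1 (nat_f f)) \<and>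
        (\<forall>g\<in>findices b 0. \<forall>f\<in>findices b 0. T0 f g = T1 (nat_f f) (nat_f g))"
      by (intro allI impI, rule bases[OF q_Zq_qbar_unique])
    show "\<forall>L0 L1. dual_canonical_basis \<Theta> b 0 L0 \<and> dual_canonical_basis \<Theta> b 1 L1 \<longrightarrow>
        (\<forall>f\<in>findices b 0. nat_hat (L0 f) = L1 (nat_f f)) \<and>
        (\<forall>g\<in>findices b 0. \<forall>f\<in>findices b 0. L0 f g = L1 (nat_f f) (nat_f g))"
      by (intro allI impI, rule bases[OF qinv_Zqinv_qbar_unique])
  qed (rule bij_nat_hat)
qed

end
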